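(* Let $\lambda=(\lambda_1,\dots,\lambda_s)$ be a partition of $n$. Then, as polynomials in $w$, \[ \sum_{k=0}^na_{nk}(\lambda)q^{k(k-n)}H_{n-2k}(w\,|\,1/q)=[\lambda]_q!\,(q-1)^nq^{-\mathsf{n}(\lambda')}\prod_{i=1}^s\sum_{\rho\vdash\lambda_i}\frac{2^{\ell(\rho)}T_\rho(w)}{z_\rho\prod_{j=1}^{\ell(\rho)}(q^{\rho_j}-1)}. \]
   Context: For a prime power $q$, $\mathfrak{u}_\lambda(\mathbb{F}_q)$ is the nilradical of the standard parabolic subalgebra of $\mathfrak{gl}_n(\mathbb{F}_q)$ with diagonal blocks of sizes $\lambda_1,\dots,\lambda_s$, and $a_{nk}(\lambda)=\#\{X\in\mathfrak{u}_\lambda(\mathbb{F}_q):X^2=0,\ \mathrm{rank}X=k\}$ (so $a_{nk}(\lambda)=0$ for $k>n/2$). The continuous $q$-Hermite polynomials are defined by $H_0(w|q)=1$, $H_m(w|q)=0$ for $m<0$, and $H_{m+1}(w|q)=2wH_m(w|q)+(q^m-1)H_{m-1}(w|q)$ for $m\ge0$. $T_m$ are Chebyshev polynomials of the first kind ($T_m(\cos\theta)=\cos(m\theta)$) and $T_\rho=T_{\rho_1}T_{\rho_2}\cdots$. $z_\rho=\prod_i i^{m_i}m_i!$ with $m_i$ the number of parts of $\rho$ equal to $i$. $[m]_q!=\prod_{j=1}^m\frac{q^j-1}{q-1}$, $[\lambda]_q!=\prod_i[\lambda_i]_q!$, $\lambda'$ the conjugate partition, $\mathsf{n}(\lambda)=\sum_i(i-1)\lambda_i$,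 $\ell(\rho)$ the number of parts. *)

theory Defs
  imports
    "HOL-Analysis.Analysis"
    "HOL-Computational_Algebra.Polynomial"
    "Jordan_Normal_Form.DL_Rank"
begin

definition partitions :: "nat \<Rightarrow> nat list set" where
  "partitions n = {xs. sorted_wrt (\<ge>) xs \<and> (\<forall>x\<in>set xs. 0 < x) \<and> sum_list xs = n}"

lemma length_partition_le:
  assumes "\<forall>x\<in>set xs. 0 < (x::nat)"
  shows "length xs \<le> sum_list xs"
  using assms by (induction xs) auto

text \<open>Sums over \<open>partitions n\<close> are therefore sums over a finite set.\<close>
lemma finite_partitions: "finite (partitions n)"
proof (rule finite_subset)
  show "partitions n \<subseteq> {xs. set xs \<subseteq> {..n} \<and> length xs \<le> n}"
  proof
    fix xs assume "xs \<in> partitions n"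
    then have pos: "\<forall>x\<in>set xs. 0 < x" and n: "sum_list xs = n"
      by (simp_all add: partitions_def)
    have "length xs \<le> n" using length_partition_le[OF pos] n by simp
    moreover have "x \<le> n" if "x \<in> set xs" for x
      using member_le_sum_list[OF that] n by simp
    ultimately show "xs \<in> {xs. set xs \<subseteq> {..n} \<and> length xs \<le> n}" by auto
  qed
  show "finite {xs. set xs \<subseteq> {..n} \<and> length xs \<le> n}"
    by (rule finite_lists_length_le) simp
qed

definition conjugate_partition :: "nat list \<Rightarrow> nat list" where
  "conjugate_partition xs =
     map (\<lambda>j. card {i. i < length xs \<and> j < xs ! i}) [0..<foldr max xs 0]"

text \<open>List positions count from 0, so the weight \<open>i - 1\<close> of the \<open>i\<close>-th part becomes \<open>i\<close>.\<close>
definition n_stat :: "nat list \<Rightarrow> nat" where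
  "n_stat xs = (\<Sum>i<length xs. i * xs ! i)"

text \<open>Integers \<open>i\<close> that are not parts would contribute the factor 1.\<close>
definition z_partition :: "nat list \<Rightarrow> nat" where
  "z_partition xs = (\<Prod>i\<in>set xs. i ^ count_list xs i * fact (count_list xs i))"

definition q_fact :: "real \<Rightarrow> nat \<Rightarrow> real" where
  "q_fact q m = (\<Prod>j=1..m. (q ^ j - 1) / (q - 1))"

definition q_fact_partition :: "real \<Rightarrow> nat list \<Rightarrow> real" where
  "q_fact_partition q xs = (\<Prod>i<length xs. q_fact q (xs ! i))"

fun q_Hermite_nat :: "real \<Rightarrow> nat \<Rightarrow> real poly" where
  "q_Hermite_nat q 0 = 1"
| "q_Hermite_nat q (Suc 0) = [:0, 2:]"
| "q_Hermite_nat q (Suc (Suc m)) =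
     [:0, 2:] * q_Hermite_nat q (Suc m) + Polynomial.smult (q ^ Suc m - 1) (q_Hermite_nat q m)"

definition q_Hermite :: "real \<Rightarrow> int \<Rightarrow> real poly" where
  "q_Hermite q m = (if m < 0 then 0 else q_Hermite_nat q (nat m))"

text \<open>The defining recurrence, uniformly for \<open>m \<ge> 0\<close>.\<close>
lemma q_Hermite_0: "q_Hermite q 0 = 1"
  by (simp add: q_Hermite_def)

lemma q_Hermite_neg: "m < 0 \<Longrightarrow> q_Hermite q m = 0"
  by (simp add: q_Hermite_def)

lemma q_Hermite_rec:
  "q_Hermite q (int m + 1) =
     [:0, 2:] * q_Hermite q (int m) + Polynomial.smult (q ^ m - 1) (q_Hermite q (int m - 1))"
proof (cases m)
  case 0
  then show ?thesis by (simp add: q_Hermite_def)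
next
  case (Suc k)
  have "nat (2 + int k) = Suc (Suc k)" "nat (1 + int k) = Suc k" by simp_all
  then show ?thesis using Suc by (simp add: q_Hermite_def)
qed

lemma Chebyshev_T_ex1: "\<exists>!p :: real poly. \<forall>t. poly p (cos t) = cos (real m * t)"
proof -
  have ex: "\<exists>p :: real poly. \<forall>t. poly p (cos t) = cos (real m * t)" for m
  proof (induction m rule: less_induct)
    case (less m)
    consider "m = 0" | "m = 1" | k where "m = Suc (Suc k)"
      by (cases m; cases "m - 1") auto
    then show ?case
    proof cases
      case 1
      then show ?thesis by (intro exI[of _ 1]) simp
    next
      case 2
      then show ?thesis by (intro exI[of _ "[:0, 1:]"]) simp
    next
      case 3
      from less.IH[of "Suc k"] less.IH[of k] 3 obtain p r :: "real poly"
        where p: "\<forall>t. poly p (cos t) = cos (real (Suc k) * t)"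
          and r: "\<forall>t. poly r (cos t) = cos (real k * t)" by auto
      have "poly ([:0, 2:] * p - r) (cos t) = cos (real m * t)" for t
      proof -
        have m: "real m * t = real (Suc k) * t + t" and k: "real k * t = real (Suc k) * t - t"
          by (simp_all add: 3 algebra_simps)
        have "cos (real m * t) + cos (real k * t) = 2 * cos (real (Suc k) * t) * cos t"
          unfolding m k cos_add cos_diff by simp
        moreover have "poly p (cos t) = cos (real (Suc k) * t)" "poly r (cos t) = cos (real k * t)"
          using p r by blast+
        ultimately show ?thesis by (simp add: mult.commute mult.left_commute del: of_nat_Suc)
      qed
      then show ?thesis by blast
    qed
  qed
  show ?thesis
  proof (rule ex_ex1I)
    show "\<exists>p :: real poly. \<forall>t. poly p (cos t) = cos (real m * t)" by (rule ex)
  next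
    fix p r :: "real poly"
    assume p: "\<forall>t. poly p (cos t) = cos (real m * t)"
      and r: "\<forall>t. poly r (cos t) = cos (real m * t)"
    have "x \<in> {x. poly (p - r) x = 0}" if "x \<in> {-1..1}" for x
    proof -
      have "cos (arccos x) = x" using that by (simp add: cos_arccos)
      moreover have "poly p (cos (arccos x)) = poly r (cos (arccos x))"
        using p r by (simp del: cos_arccos)
      ultimately show ?thesis by simp
    qed
    then have "{-1..1::real} \<subseteq> {x. poly (p - r) x = 0}" by blast
    moreover have "infinite {-1..1::real}" by (simp add: infinite_Icc)
    ultimately have "infinite {x. poly (p - r) x = 0}" using finite_subset by blast
    then show "p = r" using poly_roots_finite[of "p - r"] by auto
  qed
qed

definition Chebyshev_T :: "nat \<Rightarrow> real poly" where
  "Chebyshev_T m = (THE p. \<forall>t. poly p (cos t) = cos (real m * t))"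

lemma poly_Chebyshev_T_cos: "poly (Chebyshev_T m) (cos t) = cos (real m * t)"
  using theI'[OF Chebyshev_T_ex1[of m]] unfolding Chebyshev_T_def by blast

definition Chebyshev_T_partition :: "nat list \<Rightarrow> real poly" where
  "Chebyshev_T_partition xs = prod_list (map Chebyshev_T xs)"

text \<open>\<open>block_index lam i\<close> is the number (counting from 0) of the diagonal block of sizes
  \<open>lam\<close> to which the row or column with index \<open>i\<close> (counting from 0) belongs.\<close>
fun block_index :: "nat list \<Rightarrow> nat \<Rightarrow> nat" where
  "block_index [] i = 0"
| "block_index (b # bs) i = (if i < b then 0 else Suc (block_index bs (i - b)))"

text \<open>The standard parabolic subalgebra consists of the block upper triangular matrices; its
  nilradical is the part with vanishing diagonal blocks.  This is the usual convention for
  parabolic subalgebras of \<open>\<gg>\<ll>\<^sub>n\<close>: the scalar matrices are not included.\<close>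
definition parabolic :: "nat list \<Rightarrow> 'a :: field mat set" where
  "parabolic lam = {X \<in> carrier_mat (sum_list lam) (sum_list lam).
     \<forall>i<sum_list lam. \<forall>j<sum_list lam.
       block_index lam i > block_index lam j \<longrightarrow> X $$ (i, j) = 0}"

definition nilradical :: "nat list \<Rightarrow> 'a :: field mat set" where
  "nilradical lam = {X \<in> parabolic lam.
     \<forall>i<sum_list lam. \<forall>j<sum_list lam.
       block_index lam i = block_index lam j \<longrightarrow> X $$ (i, j) = 0}"

definition square_zero_rank ::
  "nat list \<Rightarrow> nat \<Rightarrow> 'a :: {field, finite} mat set" where
  "square_zero_rank lam k = {X \<in> nilradical lam.
     X * X = 0\<^sub>m (sum_list lam) (sum_list lam) \<and> vec_space.rank (sum_list lam) X = k}"

definition num_square_zero ::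
  "'a :: {field, finite} itself \<Rightarrow> nat \<Rightarrow> nat list \<Rightarrow> nat" where
  "num_square_zero _ k lam = card (square_zero_rank lam k :: 'a mat set)"

lemma finite_carrier_mat: "finite (carrier_mat m n :: 'a :: finite mat set)"
proof (rule finite_subset)
  show "(carrier_mat m n :: 'a mat set) \<subseteq>
      (\<lambda>f. mat m n f) ` ({..<m} \<times> {..<n} \<rightarrow>\<^sub>E (UNIV :: 'a set))"
  proof
    fix X :: "'a mat" assume X: "X \<in> carrier_mat m n"
    have "X = mat m n (restrict (\<lambda>ij. X $$ ij) ({..<m} \<times> {..<n}))"
      using X by (intro eq_matI) auto
    moreover have "restrict (\<lambda>ij. X $$ ij) ({..<m} \<times> {..<n}) \<in> {..<m} \<times> {..<n} \<rightarrow>\<^sub>E UNIV"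
      by simp
    ultimately show "X \<in> (\<lambda>f. mat m n f) ` ({..<m} \<times> {..<n} \<rightarrow>\<^sub>E (UNIV :: 'a set))"
      by (metis image_eqI)
  qed
  have "finite ({..<m} \<times> {..<n} \<rightarrow>\<^sub>E (UNIV :: 'a set))"
    by (rule finite_PiE) simp_all
  then show "finite ((\<lambda>f. mat m n f) ` ({..<m} \<times> {..<n} \<rightarrow>\<^sub>E (UNIV :: 'a set)))"
    by (rule finite_imageI)
qed

text \<open>So the cardinality in \<open>num_square_zero\<close> is a genuine count.\<close>
lemma finite_square_zero_rank:
  "finite (square_zero_rank lam k :: 'a :: {field, finite} mat set)"
  by (rule finite_subset[OF _ finite_carrier_mat])
     (auto simp: square_zero_rank_def nilradical_def parabolic_def)

end

theory Submission
  imports Defs "Jordan_Normal_Form.Matrix_Kernel"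
begin

text \<open>Both sides equal \<open>\<Prod>\<^sub>i H\<^sub>\<lambda>\<^sub>i(w | 1/q)\<close>.

  For the right-hand side, \<open>h\<^sub>n = \<Sum>\<^sub>\<rho> c\<^sub>\<rho> / z\<^sub>\<rho>\<close> satisfies Newton's identity, so its generating
  function \<open>F\<close> solves \<open>t F' = C F\<close>.  For \<open>c\<^sub>i = 2 T\<^sub>i / (q\<^sup>i - 1)\<close> the series \<open>(1 - 2wt + t\<^sup>2) F(qt)\<close>
  solves the same equation, because \<open>C(qt) - C(t)\<close> is the generating function of the
  \<open>2 T\<^sub>i\<close>; hence both agree, which is the three-term recurrence of the \<open>q\<close>-Hermite polynomials.

  For the left-hand side, induct on the number of blocks.  Adding a last block of size \<open>b\<close> to a
  matrix \<open>Y\<close> of size \<open>m\<close> with \<open>Y\<^sup>2 = 0\<close> amounts to choosing \<open>b\<close> columns in \<open>ker Y\<close>, which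
  contains the range of \<open>Y\<close> with codimension \<open>M = m - 2 rank Y\<close>.  Counting these choices by
  the resulting rank gives, up to powers of \<open>q\<close>, the coefficients of the linearization of
  \<open>H\<^sub>M H\<^sub>b\<close>.\<close>

subsection \<open>Newton's identity for sums over partitions\<close>

text \<open>Multisets replace sorted lists here so that removing a part of a partition is plain
  multiset subtraction, with no re-sorting.\<close>

definition mset_partitions :: "nat \<Rightarrow> nat multiset set" where
  "mset_partitions n = {M. 0 \<notin># M \<and> sum_mset M = n}"

definition z_mset :: "nat multiset \<Rightarrow> nat" where
  "z_mset M = (\<Prod>i\<in>set_mset M. i ^ count M i * fact (count M i))"

lemma bij_betw_mset_partitions: "bij_betw mset (partitions n) (mset_partitions n)"
proof (rule bij_betwI[where g = "\<lambda>M. rev (sorted_list_of_multiset M)"])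
  show "mset \<in> partitions n \<rightarrow> mset_partitions n"
    by (auto simp: partitions_def mset_partitions_def sum_mset_sum_list)
  show "(\<lambda>M. rev (sorted_list_of_multiset M)) \<in> mset_partitions n \<rightarrow> partitions n"
  proof
    fix M assume "M \<in> mset_partitions n"
    moreover have "sum_list (sorted_list_of_multiset M) = sum_mset M"
      by (metis mset_sorted_list_of_multiset sum_mset_sum_list)
    ultimately show "rev (sorted_list_of_multiset M) \<in> partitions n"
      unfolding partitions_def mset_partitions_def
      by (auto simp: sorted_wrt_rev sum_list_rev intro!: Nat.gr0I)
  qed
next
  fix xs assume "xs \<in> partitions n"
  then have "sorted (rev xs)" by (simp add: partitions_def sorted_wrt_rev)
  then show "rev (sorted_list_of_multiset (mset xs)) = xs"
    by (metis mset_rev rev_rev_ident sorted_list_of_multiset_mset sorted_sort_id)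
qed simp

lemma finite_mset_partitions: "finite (mset_partitions n)"
  using bij_betw_finite[OF bij_betw_mset_partitions] finite_partitions by blast

lemma z_partition_eq_z_mset: "z_partition xs = z_mset (mset xs)"
  by (simp add: z_partition_def z_mset_def count_mset)

text \<open>An index of multiplicity 0 contributes the factor 1. This allows the values for
  \<open>M\<close> and \<open>add_mset i M\<close> to be compared over one common index set.\<close>

lemma z_mset_superset:
  assumes "finite A" "set_mset M \<subseteq> A"
  shows "z_mset M = (\<Prod>i\<in>A. i ^ count M i * fact (count M i))"
  unfolding z_mset_def using assms
  by (intro prod.mono_neutral_left) (auto simp: not_in_iff)

text \<open>Only the factor at \<open>i\<close> changes: with c its old multiplicity, i^(c+1) (c+1)!
  = i (c+1) * i^c c!. The ratio is exactly the weight that occurs in Newton's identity.\<close>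

lemma z_mset_add_mset: "z_mset (add_mset i M) = i * Suc (count M i) * z_mset M"
proof -
  let ?A = "insert i (set_mset M)" and ?f = "\<lambda>N j. j ^ count N j * fact (count N j) :: nat"
  have "z_mset (add_mset i M) = (\<Prod>j\<in>?A. ?f (add_mset i M) j)"
    by (intro z_mset_superset) auto
  also have "\<dots> = ?f (add_mset i M) i * (\<Prod>j\<in>?A - {i}. ?f (add_mset i M) j)"
    by (subst prod.remove[of _ i]) auto
  also have "(\<Prod>j\<in>?A - {i}. ?f (add_mset i M) j) = (\<Prod>j\<in>?A - {i}. ?f M j)"
    by (intro prod.cong) auto
  also have "?f (add_mset i M) i * \<dots> = i * Suc (count M i) * (?f M i * (\<Prod>j\<in>?A - {i}. ?f M j))"
    by (simp add: algebra_simps)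
  also have "?f M i * (\<Prod>j\<in>?A - {i}. ?f M j) = (\<Prod>j\<in>?A. ?f M j)"
    by (subst prod.remove[of ?A i]) auto
  also have "\<dots> = z_mset M"
    by (intro z_mset_superset[symmetric]) auto
  finally show ?thesis .
qed

lemma z_mset_pos: "0 \<notin># M \<Longrightarrow> z_mset M > 0"
  unfolding z_mset_def by (intro prod_pos) (auto intro!: Nat.gr0I)

definition partition_sum :: "(nat \<Rightarrow> real) \<Rightarrow> nat \<Rightarrow> real" where
  "partition_sum c n = (\<Sum>M\<in>mset_partitions n. (\<Prod>i\<in>#M. c i) / real (z_mset M))"

lemma partition_sum_0: "partition_sum c 0 = 1"
proof -
  have "mset_partitions 0 = {{#}}"
    by (auto simp: mset_partitions_def) (metis multiset_nonemptyE)
  then show ?thesis by (simp add: partition_sum_def z_mset_def)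
qed

text \<open>Write \<open>n\<close> as the sum of the parts of each partition of \<open>n\<close>, then remove one part \<open>i\<close>.\<close>
lemma partition_sum_Newton:
  "real n * partition_sum c n = (\<Sum>i=1..n. c i * partition_sum c (n - i))"
proof -
  let ?w = "\<lambda>M. (\<Prod>i\<in>#M. c i) / real (z_mset M)"
  have "real n * ?w M = (\<Sum>i\<in>set_mset M. real (count M i * i) * ?w M)"
    if "M \<in> mset_partitions n" for M
  proof -
    obtain xs where xs: "M = mset xs" by (metis ex_mset)
    have "n = (\<Sum>i\<in>set_mset M. count M i * i)"
      using that sum_list_map_eq_sum_count[of "\<lambda>i. i" xs]
      by (simp add: mset_partitions_def xs sum_mset_sum_list count_mset)
    then have "real n = (\<Sum>i\<in>set_mset M. real (count M i * i))"
      by (metis (no_types, lifting) of_nat_sum sum.cong)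
    then show ?thesis by (simp add: sum_distrib_right sum_divide_distrib)
  qed
  then have "real n * partition_sum c n =
      (\<Sum>M\<in>mset_partitions n. \<Sum>i\<in>set_mset M. real (count M i * i) * ?w M)"
    by (simp add: partition_sum_def sum_distrib_left)
  also have "\<dots> = (\<Sum>(M, i)\<in>(SIGMA M:mset_partitions n. set_mset M). real (count M i * i) * ?w M)"
    by (simp add: sum.Sigma finite_mset_partitions)
  also have "\<dots> = (\<Sum>(i, N)\<in>(SIGMA i:{1..n}. mset_partitions (n - i)). c i * ?w N)"
  proof (rule sum.reindex_bij_witness[where i = "\<lambda>(i, N). (add_mset i N, i)"
        and j = "\<lambda>(M, i). (i, M - {#i#})"], goal_cases)
    case (2 a)
    then obtain M i where a: "a = (M, i)" "M \<in> mset_partitions n" "i \<in># M" by auto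
    define N where "N = M - {#i#}"
    have M: "M = add_mset i N" using a by (simp add: N_def)
    have "0 < i" "0 \<notin># N" "n = i + sum_mset N"
      using a M by (auto simp: mset_partitions_def intro!: Nat.gr0I)
    then show ?case by (simp add: a(1) mset_partitions_def flip: N_def)
  next
    \<comment> \<open>The weights agree: \<open>z_mset M\<close> is \<open>count M i * i\<close>
      times \<open>z_mset N\<close>, so the multiplicity and the part cancel and only
      \<open>c i\<close> remains.\<close>
    case (5 a)
    then obtain M i where a: "a = (M, i)" "M \<in> mset_partitions n" "i \<in># M" by auto
    define N where "N = M - {#i#}"
    have M: "M = add_mset i N" using a by (simp add: N_def)
    have "0 < i" "0 \<notin># N" using a M by (auto simp: mset_partitions_def intro!: Nat.gr0I)
    then have "real i \<noteq> 0" "real (z_mset N) \<noteq> 0" "real (Suc (count N i)) \<noteq> 0"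
      using z_mset_pos by (auto simp del: of_nat_Suc)
    then show ?case
      unfolding a(1) prod.case N_def[symmetric] M
      by (simp add: z_mset_add_mset del: of_nat_Suc mult_Suc mult_Suc_right)
  qed (auto simp: mset_partitions_def)
  also have "\<dots> = (\<Sum>i=1..n. c i * partition_sum c (n - i))"
    by (simp add: sum.Sigma finite_mset_partitions partition_sum_def sum_distrib_left)
  finally show ?thesis .
qed

subsection \<open>Sums over partitions and continuous q-Hermite polynomials\<close>

lemma Chebyshev_T_eqI:
  assumes "\<And>t. poly p (cos t) = cos (real m * t)"
  shows "Chebyshev_T m = p"
  unfolding Chebyshev_T_def using assms by (intro the1_equality Chebyshev_T_ex1) blast

lemma Chebyshev_T_0: "Chebyshev_T 0 = 1"
  by (rule Chebyshev_T_eqI) simp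

lemma Chebyshev_T_1: "Chebyshev_T (Suc 0) = [:0, 1:]"
  by (rule Chebyshev_T_eqI) simp

lemma Chebyshev_T_rec:
  "Chebyshev_T (Suc (Suc m)) = [:0, 2:] * Chebyshev_T (Suc m) - Chebyshev_T m"
proof (rule Chebyshev_T_eqI)
  fix t
  have 1: "real (Suc (Suc m)) * t = real (Suc m) * t + t" "real m * t = real (Suc m) * t - t"
    by (simp_all add: algebra_simps)
  show "poly ([:0, 2:] * Chebyshev_T (Suc m) - Chebyshev_T m) (cos t) = cos (real (Suc (Suc m)) * t)"
    unfolding poly_diff poly_mult poly_Chebyshev_T_cos 1 cos_add cos_diff
    by (simp add: algebra_simps)
qed

text \<open>As \<open>C\<close> has no constant term, the coefficient of t^n in the equation for d =
  f - g reads n d_n = sum over i >= 1 of C_i d_(n-i). It determines d_n from earlier coefficients,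
  and d_0 = 0.\<close>

lemma fps_Euler_equation_unique:
  fixes f g C :: "real fps"
  assumes f: "fps_X * fps_deriv f = C * f" and g: "fps_X * fps_deriv g = C * g"
    and C: "fps_nth C 0 = 0" and 0: "fps_nth f 0 = fps_nth g 0"
  shows "f = g"
proof -
  have "fps_nth (f - g) n = 0" for n
  proof (induction n rule: less_induct)
    case (less n)
    show ?case
    proof (cases n)
      case 0
      then show ?thesis using assms(4) by simp
    next
      case (Suc m)
      have "fps_X * fps_deriv (f - g) = C * (f - g)"
        using f g by (simp add: algebra_simps)
      then have "real n * fps_nth (f - g) n = (\<Sum>i=0..n. fps_nth C i * fps_nth (f - g) (n - i))"
        using Suc by (metis fps_mult_nth fps_X_mult_nth fps_deriv_nth Suc_eq_plus1 diff_Suc_1 nat.distinct(1))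
      also have "\<dots> = 0"
      proof (intro sum.neutral ballI)
        fix i assume "i \<in> {0..n}"
        then show "fps_nth C i * fps_nth (f - g) (n - i) = 0"
          using C less.IH[of "n - i"] Suc by (cases "i = 0") auto
      qed
      finally show ?thesis using Suc by simp
    qed
  qed
  then show ?thesis by (intro fps_ext) simp
qed

text \<open>Both claims are coefficients of the functional equation F(t) = (1 - 2xt + t^2) F(qt) for
  the generating function of the partition sums.\<close>

lemma partition_sum_Chebyshev_rec:
  fixes q x :: real
  assumes q: "q > 1"
  defines "e \<equiv> partition_sum (\<lambda>i. 2 * poly (Chebyshev_T i) x / (q ^ i - 1))"
  shows "(q - 1) * e 1 = 2 * x"
    and "(q ^ Suc (Suc n) - 1) * e (Suc (Suc n)) = 2 * x * q ^ Suc n * e (Suc n) - q ^ n * e n"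
proof -
  define t where "t i = poly (Chebyshev_T i) x" for i
  have t: "t 0 = 1" "t (Suc 0) = x" "\<And>m. t (Suc (Suc m)) = 2 * x * t (Suc m) - t m"
    by (simp_all add: t_def Chebyshev_T_0 Chebyshev_T_1 Chebyshev_T_rec)
  \<comment> \<open>Setting \<open>c 0 = 0\<close> gives \<open>C\<close> the zero constant term
    that uniqueness requires; the formula itself would divide by 0.\<close>
  define c where "c i = (if i = 0 then 0 else 2 * t i / (q ^ i - 1))" for i
  define C F A where "C = Abs_fps c" and "F = Abs_fps e" and "A = 1 - fps_const (2 * x) * fps_X + fps_X ^ 2"
  \<comment> \<open>\<open>D\<close> is the substitution of qt for t.\<close>
  define D where "D f = f oo (fps_const q * fps_X)" for f :: "real fps"
  have D_nth: "fps_nth (D f) n = q ^ n * fps_nth f n" for f n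
    by (simp add: D_def fps_nth_compose_linear)
  have D_mult: "D (f * g) = D f * D g" for f g
    by (simp add: D_def fps_compose_mult_distrib)
  have q': "q ^ i - 1 \<noteq> 0" if "i > 0" for i
    using one_less_power[OF q that] by simp
  have eF: "fps_X * fps_deriv F = C * F"
  proof (rule fps_ext)
    fix n
    have "fps_nth (C * F) n = (\<Sum>i=0..n. c i * e (n - i))"
      by (simp add: fps_mult_nth C_def F_def)
    also have "\<dots> = (\<Sum>i=1..n. 2 * t i / (q ^ i - 1) * e (n - i))"
      by (intro sum.mono_neutral_cong_right) (auto simp: c_def)
    also have "\<dots> = real n * e n"
      unfolding e_def t_def by (rule partition_sum_Newton[symmetric])
    finally show "fps_nth (fps_X * fps_deriv F) n = fps_nth (C * F) n"
      by (cases n) (simp_all add: F_def)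
  qed
  have XD: "fps_X * fps_deriv (D f) = D (fps_X * fps_deriv f)" for f
    by (rule fps_ext) (auto simp: D_nth fps_X_mult_nth)
  have eDF: "fps_X * fps_deriv (D F) = D C * D F"
    unfolding XD eF by (rule D_mult)
  have A_nth: "fps_nth (A * f) n = fps_nth f n - 2 * x * (if n = 0 then 0 else fps_nth f (n - 1))
      + (if n < 2 then 0 else fps_nth f (n - 2))" for f n
    by (simp add: A_def ring_distribs fps_X_power_mult_nth mult.assoc fps_X_mult_nth)
  \<comment> \<open>Subtraction produces the factor q^n - 1, which cancels the denominator of
    \<open>c n\<close>.\<close>
  have DC: "fps_nth (D C - C) n = (if n = 0 then 0 else 2 * t n)" for n
    using q'[of n] by (auto simp: D_nth C_def c_def field_simps)
  \<comment> \<open>This is the generating function of the Chebyshev polynomials: the sum of 2 T_n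
    t^n over n >= 1 equals (2xt - 2t^2) / (1 - 2xt + t^2), with numerator -t A'. From degree 3 on,
    the recurrence makes the coefficients vanish.\<close>
  have "A * (D C - C) = - (fps_X * fps_deriv A)"
  proof (rule fps_ext)
    fix n
    consider "n = 0" | "n = 1" | "n = 2" | m where "n = Suc (Suc (Suc m))"
      by (metis One_nat_def Suc_1 not0_implies_Suc)
    then show "fps_nth (A * (D C - C)) n = fps_nth (- (fps_X * fps_deriv A)) n"
        unfolding A_nth DC
      by cases (auto simp: A_def t fps_X_mult_nth fps_X_power_nth numeral_2_eq_2 fps_numeral_nth algebra_simps)
  qed
  moreover have "fps_X * fps_deriv (A * D F) = (fps_X * fps_deriv A) * D F + A * (fps_X * fps_deriv (D F))"
    by (simp add: algebra_simps)
  ultimately have "fps_X * fps_deriv (A * D F) = - (A * (D C - C)) * D F + A * (D C * D F)"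
    by (simp add: eDF)
  \<comment> \<open>The two \<open>D C\<close> terms cancel, so \<open>A * D F\<close> solves the
    same equation as \<open>F\<close>.\<close>
  then have "fps_X * fps_deriv (A * D F) = C * (A * D F)"
    by (simp add: algebra_simps)
  moreover have "fps_nth F 0 = fps_nth (A * D F) 0"
    unfolding A_nth D_nth by simp
  ultimately have "F = A * D F"
    by (intro fps_Euler_equation_unique[OF eF]) (simp_all add: C_def c_def)
  then have F_nth: "fps_nth F n = fps_nth (A * D F) n" for n
    by simp
  have "fps_nth F = e"
    by (simp add: F_def fun_eq_iff)
  then have rec: "e n = q ^ n * e n - 2 * x * (if n = 0 then 0 else q ^ (n - 1) * e (n - 1))
      + (if n < 2 then 0 else q ^ (n - 2) * e (n - 2))" for n
    using F_nth[of n] unfolding A_nth D_nth by (simp only:)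
  show "(q - 1) * e 1 = 2 * x"
    using rec[of 1] by (simp add: e_def partition_sum_0 algebra_simps)
  show "(q ^ Suc (Suc n) - 1) * e (Suc (Suc n)) = 2 * x * q ^ Suc n * e (Suc n) - q ^ n * e n"
    using rec[of "Suc (Suc n)"] by (simp add: algebra_simps)
qed

text \<open>Clearing the denominators q^j - 1 turns the recurrence of the partition sums into that
  of the q-Hermite polynomials at base 1/q, up to the power of q with exponent n(n-1)/2.\<close>

lemma partition_sum_Chebyshev_eq_q_Hermite:
  fixes q x :: real
  assumes q: "q > 1"
  shows "(\<Prod>j=1..n. q ^ j - 1) * partition_sum (\<lambda>i. 2 * poly (Chebyshev_T i) x / (q ^ i - 1)) n =
    q ^ (\<Sum>j<n. j) * poly (q_Hermite_nat (1 / q) n) x"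
proof (induction n rule: induct_nat_012)
  case 0
  then show ?case by (simp add: partition_sum_0)
next
  case 1
  then show ?case using partition_sum_Chebyshev_rec(1)[OF q, of x] by simp
next
  case (ge2 n)
  let ?e = "partition_sum (\<lambda>i. 2 * poly (Chebyshev_T i) x / (q ^ i - 1))"
  let ?P = "\<lambda>n. \<Prod>j=1..n. q ^ j - 1" and ?H = "\<lambda>n. poly (q_Hermite_nat (1 / q) n) x"
  let ?s = "\<lambda>n. q ^ (\<Sum>j<n. j)"
  have "?P (Suc (Suc n)) * ?e (Suc (Suc n)) =
      ?P (Suc n) * ((q ^ Suc (Suc n) - 1) * ?e (Suc (Suc n)))"
    by simp
  also have "\<dots> = ?P (Suc n) * (2 * x * q ^ Suc n * ?e (Suc n) - q ^ n * ?e n)"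
    by (subst partition_sum_Chebyshev_rec(2)[OF q]) simp
  also have "\<dots> = 2 * x * q ^ Suc n * (?P (Suc n) * ?e (Suc n)) - q ^ n * (q ^ Suc n - 1) * (?P n * ?e n)"
    by (simp add: algebra_simps)
  also have "\<dots> = 2 * x * q ^ Suc n * (?s (Suc n) * ?H (Suc n)) - q ^ n * (q ^ Suc n - 1) * (?s n * ?H n)"
    by (simp only: ge2)
  \<comment> \<open>Here \<open>?s (Suc n) = q ^ n * ?s n\<close>, and q^(n+1) - 1 = -q^(n+1)
    ((1/q)^(n+1) - 1).\<close>
  also have "\<dots> = q ^ Suc n * ?s (Suc n) * (2 * x * ?H (Suc n) + ((1 / q) ^ Suc n - 1) * ?H n)"
    using q by (simp add: power_add field_simps)
  also have "q ^ Suc n * ?s (Suc n) = ?s (Suc (Suc n))"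
    by (simp add: power_add algebra_simps)
  also have "2 * x * ?H (Suc n) + ((1 / q) ^ Suc n - 1) * ?H n = ?H (Suc (Suc n))"
    by (simp add: algebra_simps)
  finally show ?case .
qed

subsection \<open>Linearization of products of q-Hermite polynomials\<close>

text \<open>The truncated subtractions are harmless: for \<open>j > min M b\<close> the product contains a
  vanishing factor.\<close>
definition linearization_coeff :: "real \<Rightarrow> nat \<Rightarrow> nat \<Rightarrow> nat \<Rightarrow> real" where
  "linearization_coeff p M b j = (\<Prod>t<j. (1 - p ^ (M - t)) * (1 - p ^ (b - t)) / (1 - p ^ Suc t))"

lemma linearization_coeff_0 [simp]: "linearization_coeff p M b 0 = 1"
  by (simp add: linearization_coeff_def)

lemma linearization_coeff_Suc:
  "linearization_coeff p M b (Suc j) =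
     linearization_coeff p M b j * ((1 - p ^ (M - j)) * (1 - p ^ (b - j)) / (1 - p ^ Suc j))"
  by (simp add: linearization_coeff_def)

lemma linearization_coeff_eq_0: "M < j \<or> b < j \<Longrightarrow> linearization_coeff p M b j = 0"
  unfolding linearization_coeff_def by (rule prod_zero) (auto intro: bexI[of _ M] bexI[of _ b])

text \<open>The p-analogue of (b+1-j) C(b+1,j) = (b+1) C(b,j): the coefficient is the product of the
  Gaussian binomials of (M,j) and (b,j) and of (1-p)...(1-p^j), and only the second binomial depends
  on b.\<close>

lemma linearization_coeff_absorb:
  assumes p: "0 < p" "p < 1" and "j \<le> b"
  shows "(1 - p ^ (Suc b - j)) * linearization_coeff p M (Suc b) j =
    (1 - p ^ Suc b) * linearization_coeff p M b j"
  using \<open>j \<le> b\<close>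
proof (induction j)
  case (Suc j)
  have nz: "1 - p ^ Suc j \<noteq> 0"
    using power_less_one_iff[of p "Suc j"] p by simp
  have "(1 - p ^ (Suc b - Suc j)) * linearization_coeff p M (Suc b) (Suc j) =
      (1 - p ^ (b - j)) * ((1 - p ^ (M - j)) / (1 - p ^ Suc j)) *
      ((1 - p ^ (Suc b - j)) * linearization_coeff p M (Suc b) j)"
    by (simp add: linearization_coeff_Suc)
  also have "\<dots> = (1 - p ^ (b - j)) * ((1 - p ^ (M - j)) / (1 - p ^ Suc j)) *
      ((1 - p ^ Suc b) * linearization_coeff p M b j)"
    using Suc by simp
  also have "\<dots> = (1 - p ^ Suc b) * linearization_coeff p M b (Suc j)"
    by (simp add: linearization_coeff_Suc)
  finally show ?case .
qed simp

text \<open>The p-Pascal rule for the Gaussian binomial of (b+1,j+1), multiplied by the part of the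
  coefficient that depends only on \<open>M\<close>.\<close>

lemma linearization_coeff_Pascal:
  assumes p: "0 < p" "p < 1" and "j \<le> b"
  shows "linearization_coeff p M (Suc b) (Suc j) =
    linearization_coeff p M b (Suc j) + p ^ (b - j) * (1 - p ^ (M - j)) * linearization_coeff p M b j"
proof -
  have nz: "1 - p ^ Suc j \<noteq> 0"
    using power_less_one_iff[of p "Suc j"] p by simp
  have "linearization_coeff p M (Suc b) (Suc j) =
      (1 - p ^ (M - j)) / (1 - p ^ Suc j) * ((1 - p ^ (Suc b - j)) * linearization_coeff p M (Suc b) j)"
    by (simp add: linearization_coeff_Suc)
  also have "\<dots> = (1 - p ^ (M - j)) / (1 - p ^ Suc j) * ((1 - p ^ Suc b) * linearization_coeff p M b j)"
    by (simp only: linearization_coeff_absorb[OF p \<open>j \<le> b\<close>])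
  \<comment> \<open>This splitting separates the two Pascal terms: the first summand extends the
    product in \<open>linearization_coeff p M b j\<close> by one factor, the second cancels the
    denominator.\<close>
  also have "1 - p ^ Suc b = 1 - p ^ (b - j) + p ^ (b - j) * (1 - p ^ Suc j)"
    using \<open>j \<le> b\<close> by (simp add: algebra_simps flip: power_add)
  also have "(1 - p ^ (M - j)) / (1 - p ^ Suc j) * (\<dots> * linearization_coeff p M b j) =
      linearization_coeff p M b (Suc j) + p ^ (b - j) * (1 - p ^ (M - j)) * linearization_coeff p M b j"
    unfolding linearization_coeff_Suc using nz by (simp add: divide_simps) (simp add: algebra_simps)
  finally show ?thesis .
qed

text \<open>Both sides satisfy the same three-term recurrence in \<open>b\<close> and agree for
  \<open>b = 0\<close> and \<open>b = 1\<close>. Wherever the index on the right is negative, j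
  exceeds \<open>M\<close> and the coefficient vanishes.\<close>

lemma poly_q_Hermite_linearization:
  fixes p x :: real
  assumes p: "0 < p" "p < 1"
  shows "poly (q_Hermite p (int M)) x * poly (q_Hermite p (int b)) x =
    (\<Sum>j\<le>b. linearization_coeff p M b j * poly (q_Hermite p (int M + int b - 2 * int j)) x)"
proof -
  define h where "h m = poly (q_Hermite p m) x" for m
  let ?L = "linearization_coeff p M"
  have h_rec: "h (int m + 1) = 2 * x * h (int m) + (p ^ m - 1) * h (int m - 1)" for m
    unfolding h_def q_Hermite_rec by simp
  define S where "S b = (\<Sum>j\<le>b. ?L b j * h (int M + int b - 2 * int j))" for b
  have S_extend: "S b = (\<Sum>j\<le>N. ?L b j * h (int M + int b - 2 * int j))" if "b \<le> N" for b N
    unfolding S_def using that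
    by (intro sum.mono_neutral_left) (auto simp: linearization_coeff_eq_0)
  \<comment> \<open>The recurrence is usable only for a nonnegative index. For j > M or j > b the
    coefficient is 0, so the truncated exponent does no harm there.\<close>
  have h_step: "?L b j * (2 * x * h (int M + int b - 2 * int j)) =
      ?L b j * (h (int M + int b + 1 - 2 * int j) +
                (1 - p ^ (M + b - 2 * j)) * h (int M + int b - 1 - 2 * int j))" for b j
  proof (cases "j \<le> M \<and> j \<le> b")
    case True
    then have "int (M + b - 2 * j) = int M + int b - 2 * int j" by (simp add: of_nat_diff)
    then show ?thesis using h_rec[of "M + b - 2 * j"] by (simp add: algebra_simps)
  qed (auto simp: linearization_coeff_eq_0 not_le)
  \<comment> \<open>This compares the coefficients of one polynomial on the two sides of the
    recurrence for \<open>S\<close>. Pascal's rule supplies the difference, and absorption rewrites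
    the surplus term with \<open>?L b i\<close>; \<open>i = Suc b\<close> lies outside the range of
    absorption and is treated separately.\<close>
  have L_rec: "?L (Suc (Suc b)) (Suc i) = ?L (Suc b) (Suc i) +
      ((1 - p ^ (M + Suc b - 2 * i)) * ?L (Suc b) i - (1 - p ^ Suc b) * ?L b i)" for b i
  proof -
    consider "M < i" | "Suc b < i" | "i \<le> M" "i = Suc b" | "i \<le> M" "i \<le> b" by linarith
    then show ?thesis
    proof cases
      case 3
      then show ?thesis
        using linearization_coeff_Pascal[OF p, of i "Suc b" M] by (simp add: linearization_coeff_eq_0)
    next
      case 4
      have e: "(Suc b - i) + (M - i) = M + Suc b - 2 * i" using 4 by simp
      have "?L (Suc (Suc b)) (Suc i) - ?L (Suc b) (Suc i) =
          (p ^ (Suc b - i) - p ^ (M + Suc b - 2 * i)) * ?L (Suc b) i"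
        using linearization_coeff_Pascal[OF p, of i "Suc b" M] 4
        by (simp add: right_diff_distrib e flip: power_add)
      also have "\<dots> = (1 - p ^ (M + Suc b - 2 * i)) * ?L (Suc b) i - (1 - p ^ (Suc b - i)) * ?L (Suc b) i"
        by (simp add: algebra_simps)
      finally show ?thesis
        using linearization_coeff_absorb[OF p 4(2)] by simp
    qed (auto simp: linearization_coeff_eq_0)
  qed
  have S_rec: "S (Suc (Suc b)) = 2 * x * S (Suc b) - (1 - p ^ Suc b) * S b" for b
  proof -
    have "S (Suc (Suc b)) = h (int M + int b + 2) +
        (\<Sum>i\<le>Suc b. ?L (Suc (Suc b)) (Suc i) * h (int M + int b - 2 * int i))"
      unfolding S_def sum.atMost_Suc_shift by (simp add: algebra_simps)
    also have "(\<Sum>i\<le>Suc b. ?L (Suc (Suc b)) (Suc i) * h (int M + int b - 2 * int i)) =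
        (\<Sum>i\<le>Suc b. ?L (Suc b) (Suc i) * h (int M + int b - 2 * int i)) +
        (\<Sum>i\<le>Suc b. ?L (Suc b) i * ((1 - p ^ (M + Suc b - 2 * i)) * h (int M + int b - 2 * int i))) -
        (1 - p ^ Suc b) * (\<Sum>i\<le>Suc b. ?L b i * h (int M + int b - 2 * int i))"
      unfolding sum_distrib_left sum_subtractf[symmetric] sum.distrib[symmetric] L_rec
      by (intro sum.cong) (simp_all add: algebra_simps)
    also have "(\<Sum>i\<le>Suc b. ?L b i * h (int M + int b - 2 * int i)) = S b"
      by (rule S_extend[symmetric]) simp
    also have "h (int M + int b + 2) + ((\<Sum>i\<le>Suc b. ?L (Suc b) (Suc i) * h (int M + int b - 2 * int i)) +
        (\<Sum>i\<le>Suc b. ?L (Suc b) i * ((1 - p ^ (M + Suc b - 2 * i)) * h (int M + int b - 2 * int i))) -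
        (1 - p ^ Suc b) * S b) =
        (\<Sum>i\<le>Suc (Suc b). ?L (Suc b) i * h (int M + int (Suc b) + 1 - 2 * int i)) +
        (\<Sum>i\<le>Suc b. ?L (Suc b) i * ((1 - p ^ (M + Suc b - 2 * i)) * h (int M + int (Suc b) - 1 - 2 * int i))) -
        (1 - p ^ Suc b) * S b"
      unfolding sum.atMost_Suc_shift[of _ "Suc b"] by (simp add: algebra_simps)
    also have "(\<Sum>i\<le>Suc (Suc b). ?L (Suc b) i * h (int M + int (Suc b) + 1 - 2 * int i)) =
        (\<Sum>i\<le>Suc b. ?L (Suc b) i * h (int M + int (Suc b) + 1 - 2 * int i))"
      by (simp add: linearization_coeff_eq_0)
    also have "\<dots> + (\<Sum>i\<le>Suc b. ?L (Suc b) i * ((1 - p ^ (M + Suc b - 2 * i)) *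
          h (int M + int (Suc b) - 1 - 2 * int i))) =
        (\<Sum>i\<le>Suc b. ?L (Suc b) i * (2 * x * h (int M + int (Suc b) - 2 * int i)))"
      unfolding h_step sum.distrib[symmetric] by (simp only: distrib_left)
    also have "\<dots> = 2 * x * S (Suc b)"
      by (simp add: S_def sum_distrib_left algebra_simps)
    finally show ?thesis .
  qed
  have "h (int M) * h (int b) = S b"
  proof (induction b rule: induct_nat_012)
    case 0
    then show ?case by (simp add: S_def h_def q_Hermite_0)
  next
    case 1
    have "h (int M) * h 1 = 2 * x * h (int M)"
      by (simp add: h_def q_Hermite_def)
    moreover have "S (Suc 0) = h (int M + 1) + (1 - p ^ M) * h (int M - 1)"
      using p by (simp add: S_def linearization_coeff_Suc)
    ultimately show ?case using h_rec[of M] by (simp add: algebra_simps)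
  next
    case (ge2 b)
    have "h (int (Suc (Suc b))) = 2 * x * h (int (Suc b)) - (1 - p ^ Suc b) * h (int b)"
      using h_rec[of "Suc b"] by (simp add: algebra_simps)
    then have "h (int M) * h (int (Suc (Suc b))) =
        h (int M) * (2 * x * h (int (Suc b)) - (1 - p ^ Suc b) * h (int b))"
      by (simp only:)
    also have "\<dots> = 2 * x * (h (int M) * h (int (Suc b))) - (1 - p ^ Suc b) * (h (int M) * h (int b))"
      by (simp only: right_diff_distrib ac_simps)
    finally have "h (int M) * h (int (Suc (Suc b))) =
        2 * x * (h (int M) * h (int (Suc b))) - (1 - p ^ Suc b) * (h (int M) * h (int b))" .
    then show ?case by (simp only: ge2 S_rec)
  qed
  then show ?thesis unfolding h_def S_def .
qed

subsection \<open>Counting columns in a subspace by the dimension of their span\<close>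

text \<open>Subspaces are kept as plain sets so that, over a finite field with q elements, a
  dimension d can be tracked through the cardinality q^d.\<close>

definition vec_subspace :: "nat \<Rightarrow> 'a :: field vec set \<Rightarrow> bool" where
  "vec_subspace m W \<longleftrightarrow> W \<subseteq> carrier_vec m \<and> 0\<^sub>v m \<in> W \<and>
     (\<forall>u\<in>W. \<forall>v\<in>W. u + v \<in> W) \<and> (\<forall>c. \<forall>v\<in>W. c \<cdot>\<^sub>v v \<in> W)"

definition add_line :: "'a :: field vec set \<Rightarrow> 'a vec \<Rightarrow> 'a vec set" where
  "add_line W z = (\<lambda>(w, c). w + c \<cdot>\<^sub>v z) ` (W \<times> UNIV)"

text \<open>Vectors are added one at a time, so the span of \<open>us @ zs\<close> is the fold over
  \<open>zs\<close> started at the span of \<open>us\<close>. The columns of a new block can then be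
  counted relative to the old column space.\<close>

definition list_span :: "nat \<Rightarrow> 'a :: field vec list \<Rightarrow> 'a vec set" where
  "list_span m zs = foldl add_line {0\<^sub>v m} zs"

lemma add_lineI: "w \<in> W \<Longrightarrow> w + c \<cdot>\<^sub>v z \<in> add_line W z"
  by (auto simp: add_line_def)

lemma vec_subspace_carrier: "vec_subspace m W \<Longrightarrow> v \<in> W \<Longrightarrow> v \<in> carrier_vec m"
  by (auto simp: vec_subspace_def)

lemma vec_subspace_zero: "vec_subspace m {0\<^sub>v m :: 'a :: field vec}"
  by (auto simp: vec_subspace_def)

lemma finite_carrier_vec: "finite (carrier_vec n :: 'a :: finite vec set)"
  and card_carrier_vec: "card (carrier_vec n :: 'a :: finite vec set) = CARD('a) ^ n"
proof -
  have "bij_betw vec_of_list {xs :: 'a list. set xs \<subseteq> UNIV \<and> length xs = n} (carrier_vec n)"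
    by (rule bij_betwI[where g = list_of_vec]) (auto simp: vec_list list_vec intro: carrier_vecI)
  then show "finite (carrier_vec n :: 'a vec set)" "card (carrier_vec n :: 'a vec set) = CARD('a) ^ n"
    using card_lists_length_eq[of "UNIV :: 'a set" n] finite_lists_length_eq[of "UNIV :: 'a set" n]
    by (auto simp: bij_betw_same_card[symmetric] bij_betw_finite[symmetric])
qed

lemma vec_subspace_finite:
  "vec_subspace m (W :: 'a :: {field, finite} vec set) \<Longrightarrow> finite W"
  using finite_carrier_vec finite_subset by (auto simp: vec_subspace_def)

lemma add_line_superset:
  assumes "vec_subspace m W" "z \<in> carrier_vec m"
  shows "W \<subseteq> add_line W z" "z \<in> add_line W z"
proof -
  show "W \<subseteq> add_line W z"
  proof
    fix w assume "w \<in> W"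
    moreover from this have "w = w + 0 \<cdot>\<^sub>v z"
      using assms vec_subspace_carrier[of m W w] by (intro eq_vecI) auto
    ultimately show "w \<in> add_line W z" by (metis add_lineI)
  qed
  have "z = 0\<^sub>v m + 1 \<cdot>\<^sub>v z" using assms by simp
  then show "z \<in> add_line W z" using assms by (metis add_lineI vec_subspace_def)
qed

lemma add_line_subset:
  assumes "vec_subspace m K" "W \<subseteq> K" "z \<in> K"
  shows "add_line W z \<subseteq> K"
  using assms by (auto simp: add_line_def vec_subspace_def)

lemma vec_subspace_add_line:
  assumes W: "vec_subspace m W" and z: "z \<in> carrier_vec m"
  shows "vec_subspace m (add_line W z)"
  unfolding vec_subspace_def
proof (intro conjI ballI allI)
  show "add_line W z \<subseteq> carrier_vec m"
    using W z by (auto simp: add_line_def vec_subspace_def)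
  show "0\<^sub>v m \<in> add_line W z"
    using add_line_superset(1)[OF W z] W by (auto simp: vec_subspace_def)
next
  fix u v assume "u \<in> add_line W z" "v \<in> add_line W z"
  then obtain a b c d where uv: "u = a + c \<cdot>\<^sub>v z" "v = b + d \<cdot>\<^sub>v z" "a \<in> W" "b \<in> W"
    by (auto simp: add_line_def)
  then have ab: "a \<in> carrier_vec m" "b \<in> carrier_vec m" using W vec_subspace_carrier by auto
  have "u + v = (a + b) + (c + d) \<cdot>\<^sub>v z"
    using ab z unfolding uv by (intro eq_vecI) (auto simp: algebra_simps)
  moreover have "a + b \<in> W" using uv W by (simp add: vec_subspace_def)
  ultimately show "u + v \<in> add_line W z" by (metis add_lineI)
next
  fix e v assume "v \<in> add_line W z"
  then obtain b d where v: "v = b + d \<cdot>\<^sub>v z" "b \<in> W"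
    by (auto simp: add_line_def)
  then have "b \<in> carrier_vec m" using W vec_subspace_carrier by auto
  then have "e \<cdot>\<^sub>v v = e \<cdot>\<^sub>v b + (e * d) \<cdot>\<^sub>v z"
    using z unfolding v by (intro eq_vecI) (auto simp: algebra_simps)
  moreover have "e \<cdot>\<^sub>v b \<in> W" using v W by (simp add: vec_subspace_def)
  ultimately show "e \<cdot>\<^sub>v v \<in> add_line W z" by (metis add_lineI)
qed

text \<open>For \<open>z\<close> outside \<open>W\<close> the representations w + c z are unique:
  two of them with distinct scalars could be solved for \<open>z\<close>, placing it in
  \<open>W\<close>.\<close>

lemma card_add_line:
  fixes W :: "'a :: {field, finite} vec set"
  assumes W: "vec_subspace m W" and z: "z \<in> carrier_vec m"
  shows "card (add_line W z) = (if z \<in> W then card W else CARD('a) * card W)"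
proof (cases "z \<in> W")
  case True
  then show ?thesis
    using add_line_subset[OF W order_refl] add_line_superset(1)[OF W z] by (metis subset_antisym)
next
  case False
  have "inj_on (\<lambda>(w, c). w + c \<cdot>\<^sub>v z) (W \<times> UNIV)"
  proof (rule inj_onI, clarify)
    fix a c b d assume ab: "a \<in> W" "b \<in> W" and eq: "a + c \<cdot>\<^sub>v z = b + d \<cdot>\<^sub>v z"
    have ab': "a \<in> carrier_vec m" "b \<in> carrier_vec m" using ab W vec_subspace_carrier by auto
    have eq': "vec_index a i + c * vec_index z i = vec_index b i + d * vec_index z i" if "i < m" for i
      using arg_cong[OF eq, of "\<lambda>v. vec_index v i"] that ab' z by simp
    have "c = d"
    proof (rule ccontr)
      assume "c \<noteq> d"
      have "z = inverse (d - c) \<cdot>\<^sub>v (a + (- 1) \<cdot>\<^sub>v b)"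
      proof (rule eq_vecI)
        fix i assume "i < dim_vec (inverse (d - c) \<cdot>\<^sub>v (a + - 1 \<cdot>\<^sub>v b))"
        then have i: "i < m" using ab' by simp
        have "(d - c) * vec_index z i = vec_index a i - vec_index b i"
          using eq'[OF i] by (simp add: algebra_simps)
        then show "vec_index z i = vec_index (inverse (d - c) \<cdot>\<^sub>v (a + - 1 \<cdot>\<^sub>v b)) i"
          using i ab' z \<open>c \<noteq> d\<close> by (simp add: field_simps)
      qed (use ab' z in auto)
      moreover have "inverse (d - c) \<cdot>\<^sub>v (a + (- 1) \<cdot>\<^sub>v b) \<in> W"
        using W ab by (simp add: vec_subspace_def)
      ultimately show False using False by metis
    qed
    moreover have "a = b"
      using eq' \<open>c = d\<close> ab' by (intro eq_vecI) auto
    ultimately show "a = b \<and> c = d" by simp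
  qed
  then have "card (add_line W z) = card (W \<times> (UNIV :: 'a set))"
    unfolding add_line_def by (rule card_image)
  then show ?thesis using False by (simp add: card_cartesian_product)
qed

lemma vec_subspace_foldl_add_line:
  "vec_subspace m W \<Longrightarrow> set zs \<subseteq> carrier_vec m \<Longrightarrow> vec_subspace m (foldl add_line W zs)"
  by (induction zs arbitrary: W) (auto intro: vec_subspace_add_line)

lemma foldl_add_line_subset:
  "vec_subspace m K \<Longrightarrow> W \<subseteq> K \<Longrightarrow> set zs \<subseteq> K \<Longrightarrow> foldl add_line W zs \<subseteq> K"
  by (induction zs arbitrary: W) (auto simp: add_line_subset)

lemma foldl_add_line_superset:
  "vec_subspace m W \<Longrightarrow> set zs \<subseteq> carrier_vec m \<Longrightarrow> W \<union> set zs \<subseteq> foldl add_line W zs"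
proof (induction zs arbitrary: W)
  case (Cons z zs)
  then show ?case
    using Cons.IH[of "add_line W z"] vec_subspace_add_line[of m W z] add_line_superset[of m W z]
    by auto
qed simp

text \<open>Each side is a subspace containing the vectors, and each is contained in any such
  subspace. This links the cardinality counts to the span underlying matrix rank.\<close>

lemma list_span_eq_span:
  fixes us :: "'a :: field vec list"
  assumes us: "set us \<subseteq> carrier_vec m"
  shows "list_span m us = LinearCombinations.module.span class_ring (module_vec TYPE('a) m) (set us)"
proof -
  interpret vec_space "TYPE('a)" m .
  have sp: "vec_subspace m (list_span m us)"
    unfolding list_span_def using vec_subspace_zero us by (rule vec_subspace_foldl_add_line)
  show ?thesis
  proof
    have "submodule class_ring (span (set us)) V"
      using us by (intro span_is_submodule) simp
    then have "vec_subspace m (span (set us))"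
      unfolding submodule_def vec_subspace_def by (auto simp: class_ring_simps)
    then show "list_span m us \<subseteq> span (set us)"
      unfolding list_span_def using in_own_span[of "set us"] us
      by (intro foldl_add_line_subset) (auto simp: vec_subspace_def)
    have "submodule class_ring (list_span m us) V"
      unfolding submodule_def using sp vec_module
      by (auto simp: vec_subspace_def class_ring_simps)
    moreover have "set us \<subseteq> list_span m us"
      unfolding list_span_def using foldl_add_line_superset[OF vec_subspace_zero us] by simp
    ultimately show "span (set us) \<subseteq> list_span m us"
      by (intro span_is_subset)
  qed
qed

text \<open>A maximal independent set of columns has \<open>rank\<close> many elements and spans the
  column space; adding its vectors one by one multiplies the cardinality by q each time.\<close>

lemma card_list_span_cols:
  fixes A :: "'a :: {field, finite} mat"
  assumes A: "A \<in> carrier_mat m nc"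
  shows "card (list_span m (cols A)) = CARD('a) ^ vec_space.rank m A"
proof -
  interpret vec_space "TYPE('a)" m .
  have cols: "set (cols A) \<subseteq> carrier_vec m" using A cols_dim by blast
  have indpt: "card (list_span m us) = CARD('a) ^ length us"
    if "distinct us" "set us \<subseteq> carrier_vec m" "lin_indpt (set us)" for us :: "'a vec list"
    using that
  proof (induction us rule: rev_induct)
    case (snoc z us)
    have us: "set us \<subseteq> carrier_vec m" and z: "z \<in> carrier_vec m" "z \<notin> set us" using snoc.prems by auto
    have li: "lin_indpt (set us)"
      using snoc.prems(3) by (rule subset_li_is_li) auto
    have "z \<notin> span (set us)"
      using lin_dep_iff_in_span[of "set us" z] us z li snoc.prems(3) by auto
    then have "z \<notin> list_span m us" by (simp add: list_span_eq_span[OF us])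
    moreover have "vec_subspace m (list_span m us)"
      unfolding list_span_def using vec_subspace_zero us by (rule vec_subspace_foldl_add_line)
    ultimately show ?case
      using card_add_line[of m "list_span m us" z] z snoc.IH li us snoc.prems(1)
      by (simp add: list_span_def)
  qed (simp add: list_span_def)
  obtain S where S: "maximal S (\<lambda>T. T \<subseteq> set (cols A) \<and> lin_indpt T)" "finite S"
    using maximal_exists_superset[of "set (cols A)" "\<lambda>T. T \<subseteq> set (cols A) \<and> lin_indpt T" "{}"]
      finite_lin_indpt2[of "{}"] by auto
  then have S_sub: "S \<subseteq> set (cols A)" and S_li: "lin_indpt S" by (auto simp: maximal_def)
  obtain us where us: "set us = S" "distinct us" using finite_distinct_list S(2) by blast
  have "set (cols A) \<subseteq> span S"
  proof (rule ccontr)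
    assume "\<not> set (cols A) \<subseteq> span S"
    then obtain z where z: "z \<in> set (cols A)" "z \<notin> span S" by blast
    have "z \<notin> S" using z(2) in_own_span[of S] S_sub cols by auto
    then have "lin_indpt (S \<union> {z})"
      using lin_dep_iff_in_span[of S z] S_li S_sub cols z by auto
    then show False using S(1) z(1) \<open>z \<notin> S\<close> S_sub by (auto simp: maximal_def)
  qed
  then have "span (set (cols A)) = span S"
    using S_sub cols by (intro subset_antisym span_subsetI span_is_monotone) auto
  then have "list_span m (cols A) = list_span m us"
    using us S_sub cols by (simp add: list_span_eq_span)
  then have "card (list_span m (cols A)) = CARD('a) ^ length us"
    using indpt[of us] us S_sub S_li cols by simp
  also have "length us = rank A"
    using rank_card_indpt[OF A S(1)] us distinct_card by force
  finally show ?thesis .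
qed

text \<open>For a subspace \<open>W\<close> of dimension \<open>r\<close> in a space \<open>K\<close> of dimension \<open>r + M\<close>, this is the
  number of lists of \<open>b\<close> vectors of \<open>K\<close> that span together with \<open>W\<close> a space of dimension
  \<open>r + j\<close>.\<close>
definition extension_count :: "real \<Rightarrow> nat \<Rightarrow> nat \<Rightarrow> nat \<Rightarrow> nat \<Rightarrow> real" where
  "extension_count q r M b j = q ^ (r * b + j * (M + b - j)) * linearization_coeff (1 / q) M b j"

text \<open>Combinatorially, the last vector either lies in a span already of dimension r+j+1, or
  leaves a span of dimension r+j, for which q^(r+M) - q^(r+j) vectors are available. The proof is
  Pascal's rule with p = 1/q, scaled by powers of q.\<close>

lemma extension_count_Suc:
  assumes q: "q > 1" and j: "j \<le> b"
  shows "extension_count q r M (Suc b) (Suc j) =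
    q ^ (r + Suc j) * extension_count q r M b (Suc j) + (q ^ (r + M) - q ^ (r + j)) * extension_count q r M b j"
proof -
  have p: "0 < 1 / q" "1 / q < 1" using q by auto
  let ?L = "linearization_coeff (1 / q) M b"
  have "q ^ (r * Suc b + Suc j * (M + Suc b - Suc j)) * ?L (Suc j) =
      q ^ (r + Suc j) * extension_count q r M b (Suc j)"
  proof (cases "j = b")
    case False
    then obtain d where "b = Suc j + d" using j by (metis le_neq_implies_less less_iff_Suc_add add_Suc)
    then show ?thesis by (simp add: extension_count_def power_add[symmetric] algebra_simps)
  qed (simp add: extension_count_def linearization_coeff_eq_0)
  moreover have "q ^ (r * Suc b + Suc j * (M + Suc b - Suc j)) *
      ((1 / q) ^ (b - j) * (1 - (1 / q) ^ (M - j)) * ?L j) =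
      (q ^ (r + M) - q ^ (r + j)) * extension_count q r M b j"
  proof (cases "j \<le> M")
    case True
    obtain d e where d: "b = j + d" and e: "M = j + e" using j True by (metis le_iff_add)
    have "r * Suc b + Suc j * (M + Suc b - Suc j) = (r * b + j * (M + b - j)) + (d + (r + M))"
      unfolding d e by (simp add: algebra_simps)
    then have "q ^ (r * Suc b + Suc j * (M + Suc b - Suc j)) *
        ((1 / q) ^ (b - j) * (1 - (1 / q) ^ (M - j)) * ?L j) =
        q ^ (r * b + j * (M + b - j)) * (q ^ d * q ^ (r + M)) * ((1 / q) ^ d * (1 - (1 / q) ^ e) * ?L j)"
      by (simp only: power_add) (simp add: d e)
    also have "\<dots> = (q ^ d * (1 / q) ^ d) * (q ^ (r + M) - q ^ (r + M) * (1 / q) ^ e) *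
        (q ^ (r * b + j * (M + b - j)) * ?L j)"
      by (simp only: right_diff_distrib mult_1_right ac_simps)
    also have "q ^ d * (1 / q) ^ d = 1" using q by (simp add: power_one_over)
    also have "q ^ (r + M) * (1 / q) ^ e = q ^ (r + j)"
      using q unfolding e by (simp add: power_add power_one_over)
    finally show ?thesis
      by (simp add: extension_count_def)
  qed (simp add: extension_count_def linearization_coeff_eq_0)
  ultimately show ?thesis
    unfolding extension_count_def[of q r M "Suc b"] linearization_coeff_Pascal[OF p j]
    by (simp only: distrib_left)
qed

text \<open>Induction on the length, removing the last vector: summing over it replaces the weight f
  by another function of the cardinality, so f must stay arbitrary.\<close>

lemma sum_add_line_lists:
  fixes K W :: "'a :: {field, finite} vec set" and f :: "nat \<Rightarrow> real"
  assumes K: "vec_subspace m K" "card K = CARD('a) ^ (r + M)"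
    and W: "vec_subspace m W" "W \<subseteq> K" "card W = CARD('a) ^ r"
  shows "(\<Sum>zs | set zs \<subseteq> K \<and> length zs = b. f (card (foldl add_line W zs))) =
    (\<Sum>j\<le>b. extension_count CARD('a) r M b j * f (CARD('a) ^ (r + j)))"
proof (induction b arbitrary: f)
  case 0
  have "{zs. set zs \<subseteq> K \<and> length zs = 0} = {[]}" by auto
  then show ?case by (simp add: W extension_count_def)
next
  case (Suc b)
  let ?q = "CARD('a)" and ?L = "\<lambda>b. {zs. set zs \<subseteq> K \<and> length zs = b}"
  have finK: "finite K" using K(1) by (rule vec_subspace_finite)
  have "CARD('a) > 1"
  proof -
    have "card {0, 1 :: 'a} \<le> CARD('a)" by (intro card_mono) auto
    then show ?thesis by simp
  qed
  then have q: "real ?q > 1" by simp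
  \<comment> \<open>From a span of c elements, c choices of the next vector keep the cardinality and
    the remaining vectors of \<open>K\<close> multiply it by q.\<close>
  define f' where "f' c = real c * f c + (real ?q ^ (r + M) - real c) * f (?q * c)" for c
  have step: "(\<Sum>z\<in>K. f (card (add_line V z))) = f' (card V)" if V: "vec_subspace m V" "V \<subseteq> K" for V
  proof -
    have "(\<Sum>z\<in>K. f (card (add_line V z))) = (\<Sum>z\<in>K. if z \<in> V then f (card V) else f (?q * card V))"
      using V K(1) by (intro sum.cong) (auto simp: card_add_line vec_subspace_carrier)
    also have "\<dots> = card V * f (card V) + card (K - V) * f (?q * card V)"
      using V(2) finK by (simp add: sum.If_cases Int_absorb1 Diff_eq)
    also have "real (card (K - V)) = real ?q ^ (r + M) - real (card V)"
      using card_Diff_subset[OF finite_subset[OF V(2) finK] V(2)] card_mono[OF finK V(2)] K(2)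
      by (simp add: of_nat_diff)
    finally show ?thesis by (simp add: f'_def)
  qed
  have "(\<Sum>zs\<in>?L (Suc b). f (card (foldl add_line W zs))) =
      (\<Sum>(zs, z)\<in>?L b \<times> K. f (card (add_line (foldl add_line W zs) z)))"
    by (rule sum.reindex_bij_witness[where i = "\<lambda>(zs, z). zs @ [z]" and j = "\<lambda>zs. (butlast zs, last zs)"])
       (auto simp: length_Suc_conv_rev)
  also have "\<dots> = (\<Sum>zs\<in>?L b. \<Sum>z\<in>K. f (card (add_line (foldl add_line W zs) z)))"
    by (rule sum.cartesian_product[symmetric])
  also have "\<dots> = (\<Sum>zs\<in>?L b. f' (card (foldl add_line W zs)))"
  proof (intro sum.cong refl step)
    fix zs assume "zs \<in> ?L b"
    then have zs: "set zs \<subseteq> K" by simp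
    then have "set zs \<subseteq> carrier_vec m" using K(1) by (auto simp: vec_subspace_def)
    then show "vec_subspace m (foldl add_line W zs)" by (rule vec_subspace_foldl_add_line[OF W(1)])
    show "foldl add_line W zs \<subseteq> K" using foldl_add_line_subset[OF K(1) W(2) zs] .
  qed
  also have "\<dots> = (\<Sum>j\<le>b. extension_count ?q r M b j * f' (?q ^ (r + j)))"
    by (rule Suc.IH)
  also have "\<dots> = (\<Sum>j\<le>b. real ?q ^ (r + j) * extension_count ?q r M b j * f (?q ^ (r + j))) +
      (\<Sum>j\<le>b. (real ?q ^ (r + M) - real ?q ^ (r + j)) * extension_count ?q r M b j * f (?q ^ (r + Suc j)))"
    unfolding f'_def sum.distrib[symmetric] by (intro sum.cong) (simp_all add: algebra_simps)
  \<comment> \<open>The added term j = b+1 is zero; including it lets the shifted sum align with the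
    other one.\<close>
  also have "(\<Sum>j\<le>b. real ?q ^ (r + j) * extension_count ?q r M b j * f (?q ^ (r + j))) =
      (\<Sum>j\<le>Suc b. real ?q ^ (r + j) * extension_count ?q r M b j * f (?q ^ (r + j)))"
    by (simp add: extension_count_def linearization_coeff_eq_0)
  also have "\<dots> = real ?q ^ r * extension_count ?q r M b 0 * f (?q ^ r) +
      (\<Sum>j\<le>b. real ?q ^ (r + Suc j) * extension_count ?q r M b (Suc j) * f (?q ^ (r + Suc j)))"
    unfolding sum.atMost_Suc_shift by simp
  also have "real ?q ^ r * extension_count ?q r M b 0 = extension_count ?q r M (Suc b) 0"
    by (simp add: extension_count_def power_add)
  also have "extension_count ?q r M (Suc b) 0 * f (?q ^ r) +
      (\<Sum>j\<le>b. real ?q ^ (r + Suc j) * extension_count ?q r M b (Suc j) * f (?q ^ (r + Suc j))) +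
      (\<Sum>j\<le>b. (real ?q ^ (r + M) - real ?q ^ (r + j)) * extension_count ?q r M b j * f (?q ^ (r + Suc j))) =
      extension_count ?q r M (Suc b) 0 * f (?q ^ (r + 0)) +
      (\<Sum>j\<le>b. extension_count ?q r M (Suc b) (Suc j) * f (?q ^ (r + Suc j)))"
    unfolding add.assoc sum.distrib[symmetric]
    by (intro arg_cong2[where f = "(+)"] sum.cong)
       (simp_all add: extension_count_Suc[OF q] distrib_right del: power_Suc of_nat_power)
  also have "\<dots> = (\<Sum>j\<le>Suc b. extension_count ?q r M (Suc b) j * f (?q ^ (r + j)))"
    by (rule sum.atMost_Suc_shift[symmetric])
  finally show ?case .
qed

subsection \<open>Square-zero matrices in the nilradical\<close>

lemma block_index_append_left: "i < sum_list bs \<Longrightarrow> block_index (bs @ cs) i = block_index bs i"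
  by (induction bs arbitrary: i) auto

lemma block_index_append_right:
  "sum_list bs \<le> i \<Longrightarrow> block_index (bs @ cs) i = length bs + block_index cs (i - sum_list bs)"
  by (induction bs arbitrary: i) auto

lemma block_index_less: "i < sum_list bs \<Longrightarrow> block_index bs i < length bs"
  by (induction bs arbitrary: i) auto

lemma nilradical_iff:
  "X \<in> nilradical bs \<longleftrightarrow> X \<in> carrier_mat (sum_list bs) (sum_list bs) \<and>
     (\<forall>i<sum_list bs. \<forall>j<sum_list bs. block_index bs j \<le> block_index bs i \<longrightarrow> X $$ (i, j) = 0)"
  by (auto simp: nilradical_def parabolic_def le_less)

definition extend_block :: "nat \<Rightarrow> nat \<Rightarrow> 'a :: field mat \<Rightarrow> 'a vec list \<Rightarrow> 'a mat" where
  "extend_block m b Y zs = four_block_mat Y (mat_of_cols m zs) (0\<^sub>m b m) (0\<^sub>m b b)"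

text \<open>The new block has the largest block index. Hence the new rows must vanish entirely,
  while the new columns are unrestricted above them.\<close>

lemma nilradical_extend_block:
  assumes Y: "Y \<in> carrier_mat (sum_list bs) (sum_list bs)" and zs: "length zs = b"
  shows "extend_block (sum_list bs) b Y zs \<in> nilradical (bs @ [b]) \<longleftrightarrow> Y \<in> nilradical bs"
proof -
  let ?m = "sum_list bs" and ?X = "extend_block (sum_list bs) b Y zs"
  have X: "?X \<in> carrier_mat (?m + b) (?m + b)"
    using Y zs by (simp add: extend_block_def)
  have idx: "?X $$ (i, j) = (if i < ?m \<and> j < ?m then Y $$ (i, j) else if i < ?m then vec_index (zs ! (j - ?m)) i else 0)"
    if "i < ?m + b" "j < ?m + b" for i j
    using that Y zs by (auto simp: extend_block_def mat_of_cols_index)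
  have bi: "block_index (bs @ [b]) i = (if i < ?m then block_index bs i else length bs)"
    if "i < ?m + b" for i
    using that by (auto simp: block_index_append_left block_index_append_right)
  show ?thesis
  proof
    assume "?X \<in> nilradical (bs @ [b])"
    then have X0: "?X $$ (i, j) = 0"
      if "i < ?m + b" "j < ?m + b" "block_index (bs @ [b]) j \<le> block_index (bs @ [b]) i" for i j
      using that by (simp add: nilradical_iff)
    have "Y $$ (i, j) = 0" if "i < ?m" "j < ?m" "block_index bs j \<le> block_index bs i" for i j
      using X0[of i j] idx[of i j] bi[of i] bi[of j] that by simp
    then show "Y \<in> nilradical bs" using Y by (simp add: nilradical_iff)
  next
    assume "Y \<in> nilradical bs"
    then have Y0: "Y $$ (i, j) = 0" if "i < ?m" "j < ?m" "block_index bs j \<le> block_index bs i" for i j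
      using that by (simp add: nilradical_iff)
    have "?X $$ (i, j) = 0"
      if "i < ?m + b" "j < ?m + b" "block_index (bs @ [b]) j \<le> block_index (bs @ [b]) i" for i j
      using that Y0[of i j] block_index_less[of i bs] by (auto simp: idx bi split: if_splits)
    then show "?X \<in> nilradical (bs @ [b])" using X by (simp add: nilradical_iff)
  qed
qed

text \<open>With Z the matrix of the new columns, the square has upper blocks Y^2 and YZ and zero
  lower blocks; the columns of YZ are the images of the vectors in \<open>zs\<close> under
  \<open>Y\<close>.\<close>

lemma extend_block_square_eq_0_iff:
  fixes Y :: "'a :: field mat"
  assumes Y: "Y \<in> carrier_mat m m" and zs: "set zs \<subseteq> carrier_vec m" "length zs = b"
  shows "extend_block m b Y zs * extend_block m b Y zs = 0\<^sub>m (m + b) (m + b) \<longleftrightarrow>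
    Y * Y = 0\<^sub>m m m \<and> set zs \<subseteq> mat_kernel Y"
proof -
  let ?Z = "mat_of_cols m zs"
  have Z: "?Z \<in> carrier_mat m b" using zs by auto
  have YZ: "Y * ?Z \<in> carrier_mat m b" and YY: "Y * Y \<in> carrier_mat m m" using Y Z by auto
  have "extend_block m b Y zs * extend_block m b Y zs =
      four_block_mat (Y * Y) (Y * ?Z) (0\<^sub>m b m) (0\<^sub>m b b)"
    unfolding extend_block_def
    by (subst mult_four_block_mat[OF Y Z zero_carrier_mat zero_carrier_mat Y Z zero_carrier_mat zero_carrier_mat])
       (use Y Z YZ YY zs in \<open>simp add: right_mult_zero_mat[OF Z]\<close>)
  also have "\<dots> = 0\<^sub>m (m + b) (m + b) \<longleftrightarrow> Y * Y = 0\<^sub>m m m \<and> Y * ?Z = 0\<^sub>m m b"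
  proof
    assume eq: "four_block_mat (Y * Y) (Y * ?Z) (0\<^sub>m b m) (0\<^sub>m b b) = 0\<^sub>m (m + b) (m + b)"
    have 0: "four_block_mat (Y * Y) (Y * ?Z) (0\<^sub>m b m) (0\<^sub>m b b) $$ (i, j) = 0"
      if "i < m + b" "j < m + b" for i j
      using that unfolding eq by simp
    have "(Y * Y) $$ (i, j) = 0" if "i < m" "j < m" for i j
      using 0[of i j] that YY by (simp del: index_mult_mat)
    moreover have "(Y * ?Z) $$ (i, j) = 0" if "i < m" "j < b" for i j
      using 0[of i "m + j"] that YY YZ by (simp del: index_mult_mat)
    ultimately show "Y * Y = 0\<^sub>m m m \<and> Y * ?Z = 0\<^sub>m m b"
      using YY YZ by (intro conjI eq_matI) (auto simp del: index_mult_mat)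
  qed simp
  also have "Y * ?Z = 0\<^sub>m m b \<longleftrightarrow> set zs \<subseteq> mat_kernel Y"
  proof -
    have col: "col (Y * ?Z) j = Y *\<^sub>v (zs ! j)" if "j < b" for j
      using that zs Y Z by (simp add: col_mult2[OF Y Z] subset_code(1)) (simp add: mult_mat_vec_def)
    have "Y * ?Z = 0\<^sub>m m b \<longleftrightarrow> (\<forall>j<b. Y *\<^sub>v (zs ! j) = 0\<^sub>v m)"
    proof
      assume "\<forall>j<b. Y *\<^sub>v (zs ! j) = 0\<^sub>v m"
      then show "Y * ?Z = 0\<^sub>m m b"
        using YZ Y zs by (intro mat_col_eqI) (auto simp: col)
    qed (metis col col_zero)
    also have "\<dots> \<longleftrightarrow> set zs \<subseteq> mat_kernel Y"
      using zs unfolding mat_kernel[OF Y] by (auto simp: in_set_conv_nth subset_eq all_set_conv_all_nth)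
    finally show ?thesis .
  qed
  finally show ?thesis .
qed

lemma list_span_append_zero:
  assumes "set us \<subseteq> carrier_vec m"
  shows "list_span (m + b) (map (\<lambda>u. u @\<^sub>v 0\<^sub>v b) us) = (\<lambda>u. u @\<^sub>v 0\<^sub>v b) ` list_span m us"
  using assms
proof (induction us rule: rev_induct)
  case Nil
  have "0\<^sub>v (m + b) = 0\<^sub>v m @\<^sub>v (0\<^sub>v b :: 'a vec)" by (intro eq_vecI) auto
  then show ?case by (simp add: list_span_def)
next
  case (snoc z us)
  let ?pad = "\<lambda>u. u @\<^sub>v 0\<^sub>v b"
  have "vec_subspace m (list_span m us)"
    unfolding list_span_def using snoc.prems by (intro vec_subspace_foldl_add_line vec_subspace_zero) auto
  then have "?pad w + c \<cdot>\<^sub>v ?pad z = ?pad (w + c \<cdot>\<^sub>v z)" if "w \<in> list_span m us" for w c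
    using snoc.prems that vec_subspace_carrier[of m "list_span m us" w] by (intro eq_vecI) auto
  then have "add_line (?pad ` list_span m us) (?pad z) = ?pad ` add_line (list_span m us) z"
    unfolding add_line_def by (force simp: image_iff)
  then show ?case using snoc by (simp add: list_span_def)
qed

text \<open>The columns of the extended matrix are those of \<open>Y\<close> followed by
  \<open>zs\<close>, all padded with zeros, and padding is linear and injective.\<close>

lemma card_list_span_extend_block:
  fixes Y :: "'a :: {field, finite} mat"
  assumes Y: "Y \<in> carrier_mat m m" and zs: "set zs \<subseteq> carrier_vec m" "length zs = b"
  shows "CARD('a) ^ vec_space.rank (m + b) (extend_block m b Y zs) =
    card (foldl add_line (list_span m (cols Y)) zs)"
proof -
  let ?X = "extend_block m b Y zs" and ?us = "cols Y @ zs"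
  have us: "set ?us \<subseteq> carrier_vec m" using Y zs cols_dim by fastforce
  have Z: "mat_of_cols m zs \<in> carrier_mat m b" using zs by auto
  have X: "?X \<in> carrier_mat (m + b) (m + b)" using Y by (simp add: extend_block_def)
  have "cols ?X = map (\<lambda>u. u @\<^sub>v 0\<^sub>v b) ?us"
  proof (rule nth_equalityI)
    fix j assume "j < length (cols ?X)"
    then have j: "j < m + b" using X by simp
    then have "col ?X j = ?us ! j @\<^sub>v 0\<^sub>v b"
      using col_four_block_mat[OF Y Z zero_carrier_mat[of b m] zero_carrier_mat[of b b], of j] Y zs
      unfolding extend_block_def by (cases "j < m") (auto simp: nth_append subset_code(1))
    then show "cols ?X ! j = map (\<lambda>u. u @\<^sub>v 0\<^sub>v b) ?us ! j"
      using j X Y zs by (simp del: map_append)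
  qed (use X Y zs in simp)
  then have "list_span (m + b) (cols ?X) = (\<lambda>u. u @\<^sub>v 0\<^sub>v b) ` list_span m ?us"
    using list_span_append_zero[OF us] by simp
  moreover have "inj_on (\<lambda>u. u @\<^sub>v 0\<^sub>v b) (list_span m ?us)"
  proof (rule inj_onI)
    have sp: "vec_subspace m (list_span m ?us)"
      unfolding list_span_def using us by (intro vec_subspace_foldl_add_line vec_subspace_zero) auto
    fix u v assume "u \<in> list_span m ?us" "v \<in> list_span m ?us" "u @\<^sub>v 0\<^sub>v b = v @\<^sub>v (0\<^sub>v b :: 'a vec)"
    then show "u = v"
      using append_vec_eq[of u m v] sp vec_subspace_carrier by metis
  qed
  ultimately have "card (list_span (m + b) (cols ?X)) = card (list_span m ?us)"
    by (simp add: card_image)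
  then show ?thesis
    using card_list_span_cols[OF X] by (simp add: list_span_def)
qed

section \<open>Range and kernel, and rank-nullity over a finite field\<close>

lemma list_span_cols_eq_range:
  fixes A :: "'a :: field mat"
  assumes A: "A \<in> carrier_mat m nc"
  shows "list_span m (cols A) = (\<lambda>v. A *\<^sub>v v) ` carrier_vec nc"
proof -
  interpret vec_space "TYPE('a)" m .
  have "list_span m (cols A) = col_space A"
    unfolding col_space_def using A cols_dim by (intro list_span_eq_span) blast
  also have "\<dots> = (\<lambda>v. A *\<^sub>v v) ` carrier_vec nc"
    unfolding col_space_eq[OF A] using A by auto
  finally show ?thesis .
qed

text \<open>Rank-nullity by counting: the fibres of v -> Av over the range are translates of the
  kernel.\<close>

lemma card_mat_kernel:
  fixes A :: "'a :: {field, finite} mat"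
  assumes A: "A \<in> carrier_mat m nc"
  shows "CARD('a) ^ vec_space.rank m A * card (mat_kernel A) = CARD('a) ^ nc"
proof -
  let ?R = "(\<lambda>v. A *\<^sub>v v) ` carrier_vec nc" and ?F = "\<lambda>y. {v \<in> carrier_vec nc. A *\<^sub>v v = y}"
  have fibre: "card (?F y) = card (mat_kernel A)" if "y \<in> ?R" for y
  proof -
    obtain v0 where v0: "v0 \<in> carrier_vec nc" "y = A *\<^sub>v v0" using \<open>y \<in> ?R\<close> by blast
    have "bij_betw (\<lambda>k. v0 + k) (mat_kernel A) (?F y)"
      unfolding mat_kernel[OF A]
    proof (rule bij_betwI[where g = "\<lambda>v. v - v0"])
      show "(\<lambda>k. v0 + k) \<in> {v. v \<in> carrier_vec nc \<and> A *\<^sub>v v = 0\<^sub>v m} \<rightarrow> ?F y"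
        using v0 A by (auto simp: mult_add_distrib_mat_vec[OF A])
      show "(\<lambda>v. v - v0) \<in> ?F y \<rightarrow> {v. v \<in> carrier_vec nc \<and> A *\<^sub>v v = 0\<^sub>v m}"
        using v0 A by (auto simp: mult_minus_distrib_mat_vec[OF A])
    qed (use v0 in \<open>auto intro!: eq_vecI\<close>)
    then show ?thesis by (simp add: bij_betw_same_card)
  qed
  have "CARD('a) ^ nc = card (\<Union>y\<in>?R. ?F y)"
    unfolding card_carrier_vec[symmetric] by (rule arg_cong[where f = card]) auto
  also have "\<dots> = (\<Sum>y\<in>?R. card (?F y))"
    by (intro card_UN_disjoint) (auto intro: finite_subset[OF _ finite_carrier_vec[of nc]] finite_carrier_vec)
  also have "\<dots> = card ?R * card (mat_kernel A)"
    using fibre by simp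
  also have "card ?R = CARD('a) ^ vec_space.rank m A"
    using card_list_span_cols[OF A] list_span_cols_eq_range[OF A] by simp
  finally show ?thesis by simp
qed

lemma vec_subspace_mat_kernel:
  assumes A: "A \<in> carrier_mat m nc"
  shows "vec_subspace nc (mat_kernel A)"
  unfolding vec_subspace_def mat_kernel[OF A] using A
  by (auto simp: mult_add_distrib_mat_vec[OF A] mult_mat_vec[OF A])

definition square_zero :: "nat list \<Rightarrow> 'a :: field mat set" where
  "square_zero bs = {X \<in> nilradical bs. X * X = 0\<^sub>m (sum_list bs) (sum_list bs)}"

lemma square_zero_carrier: "X \<in> square_zero bs \<Longrightarrow> X \<in> carrier_mat (sum_list bs) (sum_list bs)"
  by (simp add: square_zero_def nilradical_iff)

lemma finite_square_zero: "finite (square_zero bs :: 'a :: {field, finite} mat set)"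
  by (rule finite_subset[OF _ finite_carrier_mat]) (auto dest: square_zero_carrier)

lemma CARD_field_gt_1: "CARD('a :: {field, finite}) > 1"
proof -
  have "card {0, 1 :: 'a} \<le> CARD('a)" by (intro card_mono) auto
  then show ?thesis by simp
qed

text \<open>Y(Yv) = 0 places the range in the kernel; comparing q^r with q^(m-r) bounds the rank r
  by m/2.\<close>

lemma square_zero_range_kernel:
  fixes Y :: "'a :: {field, finite} mat"
  assumes Y: "Y \<in> carrier_mat m m" and YY: "Y * Y = 0\<^sub>m m m"
  shows "list_span m (cols Y) \<subseteq> mat_kernel Y"
    and "2 * vec_space.rank m Y \<le> m"
    and "card (mat_kernel Y) = CARD('a) ^ (m - vec_space.rank m Y)"
proof -
  let ?r = "vec_space.rank m Y"
  show sub: "list_span m (cols Y) \<subseteq> mat_kernel Y"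
  proof
    fix y assume "y \<in> list_span m (cols Y)"
    then obtain v where v: "v \<in> carrier_vec m" "y = Y *\<^sub>v v"
      using list_span_cols_eq_range[OF Y] by auto
    have "Y *\<^sub>v y = (Y * Y) *\<^sub>v v" using v Y by simp
    also have "\<dots> = 0\<^sub>v m" using v unfolding YY by (intro eq_vecI) auto
    finally show "y \<in> mat_kernel Y" using v Y by (simp add: mat_kernel[OF Y])
  qed
  have fin: "finite (mat_kernel Y)"
    using vec_subspace_mat_kernel[OF Y] by (rule vec_subspace_finite)
  have "CARD('a) ^ (?r + ?r) \<le> CARD('a) ^ ?r * card (mat_kernel Y)"
    using card_mono[OF fin sub] by (simp add: card_list_span_cols[OF Y] power_add)
  also have "\<dots> = CARD('a) ^ m" by (rule card_mat_kernel[OF Y])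
  finally show le: "2 * ?r \<le> m"
    using power_le_imp_le_exp[OF CARD_field_gt_1] by fastforce
  have "CARD('a) ^ ?r * card (mat_kernel Y) = CARD('a) ^ ?r * CARD('a) ^ (m - ?r)"
    using card_mat_kernel[OF Y] le by (simp flip: power_add)
  then show "card (mat_kernel Y) = CARD('a) ^ (m - ?r)"
    by simp
qed

text \<open>The inverse reads off the two upper blocks. Nothing is lost, since the last b rows of a
  matrix in the nilradical vanish.\<close>

lemma bij_betw_extend_block:
  "bij_betw (\<lambda>(Y, zs). extend_block (sum_list bs) b Y zs)
     (SIGMA Y:square_zero bs. {zs. set zs \<subseteq> mat_kernel Y \<and> length zs = b})
     (square_zero (bs @ [b]) :: 'a :: field mat set)"
proof -
  let ?m = "sum_list bs"
  let ?Y = "\<lambda>X :: 'a mat. mat ?m ?m (\<lambda>ij. X $$ ij)" and ?Z = "\<lambda>X :: 'a mat. mat ?m b (\<lambda>(i, j). X $$ (i, j + ?m))"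
  have ker: "mat_kernel Y \<subseteq> carrier_vec ?m" if "Y \<in> square_zero bs" for Y :: "'a mat"
    using square_zero_carrier[OF that] by (rule mat_kernel_carrier)
  show ?thesis
  proof (rule bij_betwI[where g = "\<lambda>X. (?Y X, cols (?Z X))"])
    show "(\<lambda>(Y, zs). extend_block ?m b Y zs) \<in>
        (SIGMA Y:square_zero bs. {zs. set zs \<subseteq> mat_kernel Y \<and> length zs = b}) \<rightarrow>
        (square_zero (bs @ [b]) :: 'a mat set)"
    proof
      fix a assume "a \<in> (SIGMA Y:square_zero bs. {zs. set zs \<subseteq> mat_kernel (Y :: 'a mat) \<and> length zs = b})"
      then obtain Y zs where a: "a = (Y, zs)" "Y \<in> square_zero bs" "set zs \<subseteq> mat_kernel Y" "length zs = b"
        by auto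
      then have "set zs \<subseteq> carrier_vec ?m" using ker by blast
      then show "(case a of (Y, zs) \<Rightarrow> extend_block ?m b Y zs) \<in> square_zero (bs @ [b])"
        using a square_zero_carrier[OF a(2)] nilradical_extend_block[of Y bs zs b]
          extend_block_square_eq_0_iff[of Y ?m zs b]
        by (simp add: square_zero_def)
    qed
    have X_eq: "extend_block ?m b (?Y X) (cols (?Z X)) = X" if "X \<in> square_zero (bs @ [b])" for X :: "'a mat"
    proof (rule eq_matI)
      have X: "X \<in> carrier_mat (?m + b) (?m + b)" using square_zero_carrier[OF that] by simp
      fix i j assume "i < dim_row X" "j < dim_col X"
      then have ij: "i < ?m + b" "j < ?m + b" using X by auto
      have "X $$ (i, j) = 0" if "?m \<le> i"
      proof -
        have "block_index (bs @ [b]) j \<le> block_index (bs @ [b]) i"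
          using that ij block_index_less[of j bs]
          by (cases "j < ?m") (auto simp: block_index_append_left block_index_append_right)
        then show ?thesis using \<open>X \<in> square_zero (bs @ [b])\<close> ij
          by (simp add: square_zero_def nilradical_iff)
      qed
      then show "extend_block ?m b (?Y X) (cols (?Z X)) $$ (i, j) = X $$ (i, j)"
        using ij by (auto simp: extend_block_def mat_of_cols_index)
    qed (use square_zero_carrier[OF that] in \<open>auto simp: extend_block_def\<close>)
    \<comment> \<open>By \<open>X_eq\<close> the matrix is itself an extension, so the criteria for
      the nilradical and for square zero can be read backwards.\<close>
    show "(\<lambda>X. (?Y X, cols (?Z X))) \<in> square_zero (bs @ [b]) \<rightarrow>
        (SIGMA Y:square_zero bs. {zs. set zs \<subseteq> mat_kernel (Y :: 'a mat) \<and> length zs = b})"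
    proof
      fix X :: "'a mat" assume X: "X \<in> square_zero (bs @ [b])"
      have "set (cols (?Z X)) \<subseteq> carrier_vec ?m" using cols_dim[of "?Z X"] by simp
      then show "(?Y X, cols (?Z X)) \<in> (SIGMA Y:square_zero bs. {zs. set zs \<subseteq> mat_kernel Y \<and> length zs = b})"
        using X X_eq[OF X] nilradical_extend_block[of "?Y X" bs "cols (?Z X)" b]
          extend_block_square_eq_0_iff[of "?Y X" ?m "cols (?Z X)" b]
        by (simp add: square_zero_def)
    qed
    show "(\<lambda>X. (?Y X, cols (?Z X))) (case a of (Y, zs) \<Rightarrow> extend_block ?m b Y zs) = a"
      if "a \<in> (SIGMA Y:square_zero bs. {zs. set zs \<subseteq> mat_kernel Y \<and> length zs = b})" for a :: "'a mat \<times> 'a vec list"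
    proof -
      obtain Y zs where a: "a = (Y, zs)" by (cases a)
      then have Y: "Y \<in> square_zero bs" and zs: "set zs \<subseteq> mat_kernel Y" "length zs = b"
        using that by auto
      have Yc: "Y \<in> carrier_mat ?m ?m" using Y by (rule square_zero_carrier)
      have zc: "set zs \<subseteq> carrier_vec ?m" using zs(1) ker[OF Y] by blast
      have "?Y (extend_block ?m b Y zs) = Y"
        using Yc by (intro eq_matI) (auto simp: extend_block_def)
      moreover have "?Z (extend_block ?m b Y zs) = mat_of_cols ?m zs"
        using Yc zs(2) by (intro eq_matI) (auto simp: extend_block_def)
      ultimately show ?thesis using zc by (simp add: a)
    qed
    show "(case (?Y X, cols (?Z X)) of (Y, zs) \<Rightarrow> extend_block ?m b Y zs) = X"
      if "X \<in> square_zero (bs @ [b])" for X :: "'a mat"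
      using X_eq[OF that] by simp
  qed
qed

text \<open>For fixed \<open>Y\<close> of rank r the kernel has dimension m - r = r + (m - 2r). The
  vectors of \<open>zs\<close> are therefore counted with codimension m - 2r over the column
  space.\<close>

lemma sum_square_zero_append:
  fixes g :: "nat \<Rightarrow> real" and bs :: "nat list"
  defines "m \<equiv> sum_list bs"
  shows "(\<Sum>X\<in>(square_zero (bs @ [b]) :: 'a :: {field, finite} mat set). g (vec_space.rank (m + b) X)) =
    (\<Sum>Y\<in>(square_zero bs :: 'a mat set). \<Sum>j\<le>b.
       extension_count CARD('a) (vec_space.rank m Y) (m - 2 * vec_space.rank m Y) b j * g (vec_space.rank m Y + j))"
proof -
  \<comment> \<open>The count of lists weighs a span by its cardinality, whereas g takes a rank; f
    recovers the exponent d from q^d.\<close>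
  define f where "f c = g (inv_into UNIV (\<lambda>d. CARD('a) ^ d) c)" for c
  have "inj (\<lambda>d. CARD('a) ^ d)"
    using CARD_field_gt_1[where 'a = 'a] by (simp add: inj_on_def)
  then have f: "f (CARD('a) ^ d) = g d" for d
    by (simp add: f_def inv_f_f)
  let ?L = "\<lambda>Y :: 'a mat. {zs. set zs \<subseteq> mat_kernel Y \<and> length zs = b}"
  have finL: "finite (?L Y)" if "Y \<in> square_zero bs" for Y
    using vec_subspace_finite[OF vec_subspace_mat_kernel[OF square_zero_carrier[OF that]]]
    by (rule finite_lists_length_eq)
  have "(\<Sum>X\<in>(square_zero (bs @ [b]) :: 'a mat set). g (vec_space.rank (m + b) X)) =
      (\<Sum>a\<in>(SIGMA Y:square_zero bs. ?L Y).
         g (vec_space.rank (m + b) (case a of (Y, zs) \<Rightarrow> extend_block m b Y zs)))"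
    unfolding m_def by (rule sum.reindex_bij_betw[OF bij_betw_extend_block, symmetric])
  also have "\<dots> = (\<Sum>(Y, zs)\<in>(SIGMA Y:square_zero bs. ?L Y). g (vec_space.rank (m + b) (extend_block m b Y zs)))"
    by (intro sum.cong) auto
  also have "\<dots> = (\<Sum>Y\<in>square_zero bs. \<Sum>zs\<in>?L Y. g (vec_space.rank (m + b) (extend_block m b Y zs)))"
    using finL by (intro sum.Sigma[symmetric]) (auto simp: finite_square_zero)
  also have "\<dots> = (\<Sum>Y\<in>(square_zero bs :: 'a mat set). \<Sum>j\<le>b.
      extension_count CARD('a) (vec_space.rank m Y) (m - 2 * vec_space.rank m Y) b j * g (vec_space.rank m Y + j))"
  proof (rule sum.cong[OF refl])
    fix Y :: "'a mat" assume "Y \<in> square_zero bs"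
    then have Y: "Y \<in> carrier_mat m m" "Y * Y = 0\<^sub>m m m"
      using square_zero_carrier by (auto simp: square_zero_def m_def)
    let ?r = "vec_space.rank m Y"
    note ker = square_zero_range_kernel[OF Y]
    have K: "vec_subspace m (mat_kernel Y)" using Y(1) by (rule vec_subspace_mat_kernel)
    have "(\<Sum>zs\<in>?L Y. g (vec_space.rank (m + b) (extend_block m b Y zs))) =
        (\<Sum>zs\<in>?L Y. f (card (foldl add_line (list_span m (cols Y)) zs)))"
    proof (intro sum.cong refl)
      fix zs assume "zs \<in> ?L Y"
      then have "set zs \<subseteq> carrier_vec m" "length zs = b" using K by (auto simp: vec_subspace_def)
      then show "g (vec_space.rank (m + b) (extend_block m b Y zs)) =
          f (card (foldl add_line (list_span m (cols Y)) zs))"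
        by (simp add: f flip: card_list_span_extend_block[OF Y(1)])
    qed
    also have "\<dots> = (\<Sum>j\<le>b. extension_count CARD('a) ?r (m - 2 * ?r) b j * f (CARD('a) ^ (?r + j)))"
    proof (rule sum_add_line_lists[OF K _ _ ker(1)])
      show "card (mat_kernel Y) = CARD('a) ^ (?r + (m - 2 * ?r))"
        using ker(2,3) by (simp add: mult_2)
      have "set (cols Y) \<subseteq> carrier_vec m" using Y(1) cols_dim by blast
      then show "vec_subspace m (list_span m (cols Y))"
        unfolding list_span_def by (intro vec_subspace_foldl_add_line vec_subspace_zero)
      show "card (list_span m (cols Y)) = CARD('a) ^ ?r" using Y(1) by (rule card_list_span_cols)
    qed
    finally show "(\<Sum>zs\<in>?L Y. g (vec_space.rank (m + b) (extend_block m b Y zs))) =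
        (\<Sum>j\<le>b. extension_count CARD('a) ?r (m - 2 * ?r) b j * g (?r + j))"
      by (simp only: f)
  qed
  finally show ?thesis .
qed

text \<open>Induction on the blocks, in any order of sizes: summing over the extensions of a fixed
  \<open>Y\<close> reproduces its own term times the q-Hermite polynomial of the new block, by
  linearization.\<close>

lemma sum_square_zero_q_Hermite:
  fixes x :: real
  defines "q \<equiv> real CARD('a :: {field, finite})"
  shows "(\<Sum>X\<in>(square_zero bs :: 'a mat set).
      q powi (int (vec_space.rank (sum_list bs) X) * (int (vec_space.rank (sum_list bs) X) - int (sum_list bs))) *
      poly (q_Hermite (1 / q) (int (sum_list bs) - 2 * int (vec_space.rank (sum_list bs) X))) x) =
    (\<Prod>b\<leftarrow>bs. poly (q_Hermite (1 / q) (int b)) x)"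
proof (induction bs rule: rev_induct)
  case Nil
  have "square_zero [] = {0\<^sub>m 0 0 :: 'a mat}"
    by (auto simp: square_zero_def nilradical_iff)
  moreover have "vec_space.rank 0 (0\<^sub>m 0 0 :: 'a mat) = 0"
    using vec_space.rank_le_nc[of "0\<^sub>m 0 0 :: 'a mat" 0 0] by simp
  ultimately show ?case by (simp add: q_Hermite_0)
next
  case (snoc b bs)
  let ?m = "sum_list bs"
  let ?H = "\<lambda>i. poly (q_Hermite (1 / q) i) x"
  let ?g = "\<lambda>n r. q powi (int r * (int r - int n)) * ?H (int n - 2 * int r)"
  have q: "q > 1" using CARD_field_gt_1[where 'a = 'a] by (simp add: q_def)
  have inner: "(\<Sum>j\<le>b. extension_count q r (?m - 2 * r) b j * ?g (?m + b) (r + j)) = ?g ?m r * ?H (int b)"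
    if r: "2 * r \<le> ?m" for r
  proof -
    obtain M where M: "?m = 2 * r + M" using r le_Suc_ex by blast
    have "extension_count q r M b j * ?g (2 * r + M + b) (r + j) =
        q powi (int r * (int r - int (2 * r + M))) *
        (linearization_coeff (1 / q) M b j * ?H (int M + int b - 2 * int j))" if j: "j \<le> b" for j
    proof -
      have "q ^ (r * b + j * (M + b - j)) * q powi (int (r + j) * (int (r + j) - int (2 * r + M + b))) =
          q powi (int (r * b + j * (M + b - j)) + int (r + j) * (int (r + j) - int (2 * r + M + b)))"
        using q by (simp add: power_int_add del: of_nat_add of_nat_mult)
      \<comment> \<open>All dependence of the exponent on j and b cancels, which leaves precisely
        the linearization sum.\<close>
      also have "int (r * b + j * (M + b - j)) + int (r + j) * (int (r + j) - int (2 * r + M + b)) =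
          int r * (int r - int (2 * r + M))"
      proof -
        have "int (j * (M + b - j)) = int j * (int M + int b - int j)"
          using j by (simp add: of_nat_diff)
        then show ?thesis by (simp only: of_nat_add of_nat_mult) (simp add: algebra_simps)
      qed
      finally have "q ^ (r * b + j * (M + b - j)) * q powi (int (r + j) * (int (r + j) - int (2 * r + M + b))) =
          q powi (int r * (int r - int (2 * r + M)))" .
      moreover have "int (2 * r + M + b) - 2 * int (r + j) = int M + int b - 2 * int j" by simp
      ultimately have "(q ^ (r * b + j * (M + b - j)) * q powi (int (r + j) * (int (r + j) - int (2 * r + M + b)))) *
          (linearization_coeff (1 / q) M b j * ?H (int (2 * r + M + b) - 2 * int (r + j))) =
          q powi (int r * (int r - int (2 * r + M))) *
          (linearization_coeff (1 / q) M b j * ?H (int M + int b - 2 * int j))"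
        by (simp only:)
      then show ?thesis
        unfolding extension_count_def by (simp only: ac_simps)
    qed
    then have "(\<Sum>j\<le>b. extension_count q r (?m - 2 * r) b j * ?g (?m + b) (r + j)) =
        q powi (int r * (int r - int ?m)) *
        (\<Sum>j\<le>b. linearization_coeff (1 / q) M b j * ?H (int M + int b - 2 * int j))"
      unfolding M by (simp add: sum_distrib_left)
    also have "\<dots> = q powi (int r * (int r - int ?m)) * (?H (int M) * ?H (int b))"
      using q by (subst poly_q_Hermite_linearization) auto
    also have "int M = int ?m - 2 * int r" by (simp add: M)
    finally show ?thesis by simp
  qed
  have "(\<Sum>X\<in>(square_zero (bs @ [b]) :: 'a mat set). ?g (?m + b) (vec_space.rank (?m + b) X)) =
      (\<Sum>Y\<in>(square_zero bs :: 'a mat set). ?g ?m (vec_space.rank ?m Y) * ?H (int b))"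
    unfolding sum_square_zero_append[where g = "?g (?m + b)"] q_def[symmetric]
  proof (intro sum.cong refl inner)
    fix Y :: "'a mat" assume "Y \<in> square_zero bs"
    then show "2 * vec_space.rank ?m Y \<le> ?m"
      using square_zero_carrier[of Y bs] by (intro square_zero_range_kernel(2)) (auto simp: square_zero_def)
  qed
  also have "\<dots> = (\<Prod>b\<leftarrow>bs @ [b]. ?H (int b))"
    using snoc.IH by (simp flip: sum_distrib_right)
  finally show ?case by simp
qed

subsection \<open>The product formula\<close>

text \<open>Double counting of the cells (i,j) with j < \<open>xs ! i\<close>, each of weight j, by
  columns and by rows; row i contributes the binomial coefficient of its length over 2.\<close>

lemma n_stat_conjugate_partition:
  "n_stat (conjugate_partition xs) = (\<Sum>i<length xs. \<Sum>j<xs ! i. j)"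
proof -
  let ?N = "foldr max xs 0"
  have le: "x \<le> ?N" if "x \<in> set xs" for x
    using that by (induction xs) auto
  have "n_stat (conjugate_partition xs) = (\<Sum>j<?N. j * card {i. i < length xs \<and> j < xs ! i})"
    by (simp add: n_stat_def conjugate_partition_def)
  also have "\<dots> = (\<Sum>j<?N. \<Sum>i<length xs. if j < xs ! i then j else 0)"
  proof (intro sum.cong refl)
    fix j
    have "{i. i < length xs \<and> j < xs ! i} = {..<length xs} \<inter> {i. j < xs ! i}" by auto
    then show "j * card {i. i < length xs \<and> j < xs ! i} = (\<Sum>i<length xs. if j < xs ! i then j else 0)"
      by (simp add: sum.If_cases)
  qed
  also have "\<dots> = (\<Sum>i<length xs. \<Sum>j<?N. if j < xs ! i then j else 0)"
    by (rule sum.swap)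
  also have "\<dots> = (\<Sum>i<length xs. \<Sum>j<xs ! i. j)"
  proof (rule sum.cong[OF refl])
    fix i assume "i \<in> {..<length xs}"
    then have "{..<?N} \<inter> {j. j < xs ! i} = {..<xs ! i}" using le[of "xs ! i"] by auto
    then show "(\<Sum>j<?N. if j < xs ! i then j else 0) = (\<Sum>j<xs ! i. j)"
      by (simp add: sum.If_cases)
  qed
  finally show ?thesis .
qed

text \<open>Apart from the factor with \<open>z_partition\<close>, each summand is multiplicative
  over the parts; this is what makes Newton's identity applicable.\<close>

lemma sum_partitions_Chebyshev:
  "(\<Sum>\<rho>\<in>partitions m. 2 ^ length \<rho> / (real (z_partition \<rho>) * (\<Prod>j<length \<rho>. q ^ (\<rho> ! j) - 1)) *
      poly (Chebyshev_T_partition \<rho>) x) =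
    partition_sum (\<lambda>i. 2 * poly (Chebyshev_T i) x / (q ^ i - 1)) m"
proof -
  let ?c = "\<lambda>i. 2 * poly (Chebyshev_T i) x / (q ^ i - 1)"
  have "2 ^ length \<rho> / (real (z_partition \<rho>) * (\<Prod>j<length \<rho>. q ^ (\<rho> ! j) - 1)) *
      poly (Chebyshev_T_partition \<rho>) x = (\<Prod>i\<in>#mset \<rho>. ?c i) / real (z_mset (mset \<rho>))" for \<rho>
  proof -
    have "(\<Prod>j<length \<rho>. q ^ (\<rho> ! j) - 1) = (\<Prod>i\<leftarrow>\<rho>. q ^ i - 1)"
      by (subst prod.list_conv_set_nth) (simp add: atLeast0LessThan)
    moreover have "(\<Prod>i\<leftarrow>\<rho>. ?c i) =
        2 ^ length \<rho> * poly (Chebyshev_T_partition \<rho>) x / (\<Prod>i\<leftarrow>\<rho>. q ^ i - 1)"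
      by (induction \<rho>) (simp_all add: Chebyshev_T_partition_def)
    moreover have "(\<Prod>i\<in>#mset \<rho>. ?c i) = (\<Prod>i\<leftarrow>\<rho>. ?c i)"
      by (simp only: mset_map[symmetric] prod_mset_prod_list)
    ultimately show ?thesis by (simp add: z_partition_eq_z_mset)
  qed
  then show ?thesis
    unfolding partition_sum_def sum.reindex_bij_betw[OF bij_betw_mset_partitions, symmetric]
    by (rule sum.cong[OF refl])
qed

theorem theorem2p8:
  fixes lam :: "nat list" and n :: nat and q :: real
  assumes q: "q = real CARD('a :: {field, finite})"
    and lam: "lam \<in> partitions n"
  shows
    "(\<Sum>k=0..n. Polynomial.smult (real (num_square_zero TYPE('a) k lam) * q powi (int k * (int k - int n)))
                   (q_Hermite (1 / q) (int n - 2 * int k))) =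
     Polynomial.smult (q_fact_partition q lam * (q - 1) ^ n
              * q powi (- int (n_stat (conjugate_partition lam))))
       (\<Prod>i<length lam. \<Sum>\<rho>\<in>partitions (lam ! i).
          Polynomial.smult (2 ^ length \<rho> /
                   (real (z_partition \<rho>) * (\<Prod>j<length \<rho>. (q ^ (\<rho> ! j) - 1))))
            (Chebyshev_T_partition \<rho>))"
  (is "?L = ?R")
proof -
  have q1: "q > 1" using CARD_field_gt_1[where 'a = 'a] by (simp add: q)
  have n: "sum_list lam = n" using lam by (simp add: partitions_def)
  let ?S = "square_zero lam :: 'a mat set" and ?rk = "vec_space.rank n :: 'a mat \<Rightarrow> nat"
  \<comment> \<open>Real polynomials are determined by their values.\<close>
  have "poly ?L x = poly ?R x" for x
  proof -
    let ?H = "\<lambda>m. poly (q_Hermite (1 / q) (int m)) x"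
    define G where "G k = q powi (int k * (int k - int n)) * poly (q_Hermite (1 / q) (int n - 2 * int k)) x" for k
    define c where "c i = 2 * poly (Chebyshev_T i) x / (q ^ i - 1)" for i
    \<comment> \<open>Each count is written as a sum over the matrices of rank k, so that summing
      over k removes the grouping by rank.\<close>
    have "poly ?L x = (\<Sum>k\<in>{0..n}. \<Sum>X | X \<in> ?S \<and> ?rk X = k. G (?rk X))"
      by (simp add: poly_sum G_def num_square_zero_def square_zero_rank_def square_zero_def n conj_assoc mult.assoc)
    also have "\<dots> = (\<Sum>X\<in>?S. G (?rk X))"
    proof (rule sum.group)
      have "?rk X \<le> n" if "X \<in> ?S" for X
        using square_zero_carrier[OF that] unfolding n by (rule vec_space.rank_le_nc)
      then show "?rk ` ?S \<subseteq> {0..n}" by auto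
    qed (simp_all add: finite_square_zero)
    also have "\<dots> = (\<Prod>i<length lam. ?H (lam ! i))"
      using sum_square_zero_q_Hermite[where 'a = 'a, of lam x]
      unfolding G_def n q[symmetric] prod.list_conv_set_nth
      by (simp add: atLeast0LessThan)
    finally have L: "poly ?L x = (\<Prod>i<length lam. ?H (lam ! i))" .
    \<comment> \<open>The powers of q - 1 clear the denominators of the q-factorial, leaving the
      product of the q^j - 1.\<close>
    have H: "q_fact q m * (q - 1) ^ m * (1 / q ^ (\<Sum>j<m. j)) * partition_sum c m = ?H m" for m
    proof -
      have "q_fact q m * (q - 1) ^ m = (\<Prod>j=1..m. q ^ j - 1)"
        using q1 by (simp add: q_fact_def prod_dividef)
      then show ?thesis
        using partition_sum_Chebyshev_eq_q_Hermite[OF q1, of m x] q1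
        by (simp add: c_def[abs_def] q_Hermite_def field_simps)
    qed
    \<comment> \<open>Both global prefactors split over the blocks, because n is the sum of the
      parts and the statistic of the conjugate is a sum over rows.\<close>
    have "(q - 1) ^ n = (\<Prod>i<length lam. (q - 1) ^ (lam ! i))"
      unfolding power_sum[symmetric] n[symmetric] sum_list_sum_nth atLeast0LessThan ..
    moreover have "q powi (- int (n_stat (conjugate_partition lam))) = (\<Prod>i<length lam. 1 / q ^ (\<Sum>j<lam ! i. j))"
      unfolding n_stat_conjugate_partition power_int_minus power_int_of_nat power_sum
      by (simp only: inverse_eq_divide prod_dividef prod.neutral_const)
    moreover have "poly (\<Sum>\<rho>\<in>partitions m. Polynomial.smult (2 ^ length \<rho> /
        (real (z_partition \<rho>) * (\<Prod>j<length \<rho>. (q ^ (\<rho> ! j) - 1)))) (Chebyshev_T_partition \<rho>)) x =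
        partition_sum c m" for m
      unfolding c_def sum_partitions_Chebyshev[symmetric] by (simp add: poly_sum)
    ultimately have "poly ?R x = (\<Prod>i<length lam. q_fact q (lam ! i)) * (\<Prod>i<length lam. (q - 1) ^ (lam ! i)) *
        (\<Prod>i<length lam. 1 / q ^ (\<Sum>j<lam ! i. j)) * (\<Prod>i<length lam. partition_sum c (lam ! i))"
      by (simp only: poly_smult poly_prod q_fact_partition_def)
    also have "\<dots> = (\<Prod>i<length lam. ?H (lam ! i))"
      unfolding prod.distrib[symmetric] H ..
    finally show ?thesis using L by simp
  qed
  then show ?thesis
    by (simp add: poly_eq_poly_eq_iff[symmetric] fun_eq_iff)
qed

end
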